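(* Let $\phi:\mathbb{Z}^n\times\mathbb{R}^n\to\mathbb{R}$ be a real-valued function such that the function $x\mapsto e^{i\phi(k,x)}$ is $1$-periodic for every $k\in\mathbb{Z}^n$, and let $\sigma:\mathbb{Z}^n\times\mathbb{T}^n\to\mathbb{C}$. (i) Define $\tau(x,k):=\overline{\sigma(-k,x)}$ and $\psi(x,k):=-\phi(-k,x)$. Then $$T_{\mathbb{Z}^n}(\phi,\sigma)=\mathcal{F}_{\mathbb{Z}^n}^{-1}\circ T_{\mathbb{T}^n}(\psi,\tau)^*\circ\mathcal{F}_{\mathbb{Z}^n},$$ where $T_{\mathbb{T}^n}(\psi,\tau)^*$ is the adjoint of the operator $T_{\mathbb{T}^n}(\psi,\tau)$. (ii) Assume that for all $|\alpha|\le2n+1$ and $|\beta|=1$ we have $$|\partial_x^\alpha\sigma(k,x)|\le C\quad\text{and}\quad|\partial_x^\alpha\Delta_k^\beta\phi(k,x)|\le C\quad\text{for all }(k,x)\in\mathbb{Z}^n\times\mathbb{T}^n.$$ Assume also that $$|\nabla_x\phi(k,x)-\nabla_x\phi(l,x)|\ge C|k-l|\quad\text{for all }x\in\mathbb{T}^n,\ k,l\in\mathbb{Z}^n.$$ Then $T_{\mathbb{Z}^n}(\phi,\sigma)$ extends to a bounded operator on $\ell^2(\mathbb{Z}^n)$.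
   Context: $\mathbb{T}^n=\mathbb{R}^n/\mathbb{Z}^n$; by abuse of notation one writes $x\in\mathbb{T}^n$ also for the variable of the phase functions $\phi(k,\cdot)$, $\psi(\cdot,k)$ defined on $\mathbb{R}^n$. $C$ denotes positive constants, not necessarily the same in different inequalities. Lattice Fourier transform: $(\mathcal{F}_{\mathbb{Z}^n}f)(x)=\sum_{k\in\mathbb{Z}^n}e^{-2\pi i k\cdot x}f(k)$, with inverse $\mathcal{F}_{\mathbb{Z}^n}^{-1}v(k)=\int_{\mathbb{T}^n}e^{2\pi i k\cdot x}v(x)\,dx$. Toroidal Fourier transform: $(\mathcal{F}_{\mathbb{T}^n}v)(k)=\int_{\mathbb{T}^n}e^{-2\pi i x\cdot k}v(x)\,dx$. Fourier series operators: for $f$ in the space $\mathcal{S}(\mathbb{Z}^n)$ of rapidly decreasing functions on $\mathbb{Z}^n$, $$T_{\mathbb{Z}^n}(\phi,\sigma)f(k)=\int_{\mathbb{T}^n}e^{i\phi(k,x)}\sigma(k,x)(\mathcal{F}_{\mathbb{Z}^n}f)(x)\,dx,$$ and, for a real-valued $\psi:\mathbb{R}^n\times\mathbb{Z}^n\to\mathbb{R}$ with $x\mapsto e^{i\psi(x,k)}$ $1$-periodic for every $k$, for $\tau:\mathbb{T}^n\times\mathbb{Z}^n\to\mathbb{C}$ and $v\in C^\infty(\mathbb{T}^n)$, $$T_{\mathbb{T}^n}(\psi,\tau)v(x)=\sum_{k\in\mathbb{Z}^n}e^{i\psi(x,k)}\tau(x,k)(\mathcal{F}_{\mathbb{T}^n}v)(k).$$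 Adjoints are taken with respect to the $L^2(\mathbb{T}^n)$ inner product. For $|\beta|=1$, $\Delta_k^\beta$ is one of the difference operators $\Delta_j\tau(k)=\tau(k+v_j)-\tau(k)$, $v_j$ the $j$-th standard unit vector, acting in $k$. *)

theory Defs
  imports "HOL-Analysis.Analysis"
begin

section \<open>Lattice and torus\<close>

definition lat :: "int ^ 'n \<Rightarrow> real ^ 'n" where
  "lat k = (\<chi> i. of_int (k $ i))"

text \<open>Functions on the torus are \<open>\<int>\<^sup>n\<close>-periodic functions on \<open>\<real>\<^sup>n\<close>; integrals over the torus are
  Lebesgue integrals over the unit cube.\<close>

definition periodic :: "(real ^ 'n \<Rightarrow> 'a) \<Rightarrow> bool" where
  "periodic v \<longleftrightarrow> (\<forall>x m. v (x + lat m) = v x)"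

definition unit_cube :: "(real ^ 'n) set" where
  "unit_cube = cbox 0 (\<chi> i. 1)"

definition torus_measure :: "(real ^ 'n) measure" where
  "torus_measure = lebesgue_on unit_cube"

definition char :: "int ^ 'n \<Rightarrow> real ^ 'n \<Rightarrow> complex" where
  "char k x = exp (2 * pi * \<i> * of_real (lat k \<bullet> x))"

section \<open>Derivatives and differences\<close>

definition pderiv_dir :: "'n \<Rightarrow> (real ^ 'n \<Rightarrow> 'a::real_normed_vector) \<Rightarrow> real ^ 'n \<Rightarrow> 'a" where
  "pderiv_dir i f x = vector_derivative (\<lambda>t. f (x + t *\<^sub>R axis i 1)) (at 0)"

text \<open>A multi-index \<open>\<alpha>\<close> is given as the list of the directions in which to differentiate, so
  \<open>\<bar>\<alpha>\<bar>\<close> is the length of the list. For an \<open>m\<close> times differentiable function and \<open>\<bar>\<alpha>\<bar> \<le> m\<close>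
  the order of the list is irrelevant, since mixed partial derivatives are symmetric.\<close>

primrec pderivs :: "'n list \<Rightarrow> (real ^ 'n \<Rightarrow> 'a::real_normed_vector) \<Rightarrow> real ^ 'n \<Rightarrow> 'a" where
  "pderivs [] f = f"
| "pderivs (i # \<alpha>) f = pderiv_dir i (pderivs \<alpha> f)"

primrec times_differentiable :: "nat \<Rightarrow> (real ^ 'n \<Rightarrow> 'a::real_normed_vector) \<Rightarrow> bool" where
  "times_differentiable 0 f \<longleftrightarrow> True"
| "times_differentiable (Suc m) f \<longleftrightarrow>
     (\<forall>x. f differentiable (at x)) \<and> (\<forall>i. times_differentiable m (pderiv_dir i f))"

definition grad :: "(real ^ 'n \<Rightarrow> real) \<Rightarrow> real ^ 'n \<Rightarrow> real ^ 'n" where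
  "grad f x = (\<chi> i. pderiv_dir i f x)"

definition Delta :: "'n \<Rightarrow> (int ^ 'n \<Rightarrow> real ^ 'n \<Rightarrow> real) \<Rightarrow> int ^ 'n \<Rightarrow> real ^ 'n \<Rightarrow> real" where
  "Delta j \<phi> k x = \<phi> (k + axis j 1) x - \<phi> k x"

section \<open>Function spaces\<close>

definition schwartz_lattice :: "(int ^ 'n \<Rightarrow> complex) set" where
  "schwartz_lattice = {f. \<forall>M::nat. \<exists>C. \<forall>k. cmod (f k) \<le> C / (1 + norm (lat k)) ^ M}"

definition smooth_torus :: "(real ^ 'n \<Rightarrow> complex) set" where
  "smooth_torus = {v. periodic v \<and> (\<forall>m. times_differentiable m v)}"

definition L2_torus :: "(real ^ 'n \<Rightarrow> complex) set" where
  "L2_torus = {v. periodic v \<and> v \<in> borel_measurable torus_measure \<and>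
                  integrable torus_measure (\<lambda>x. (cmod (v x))\<^sup>2)}"

definition torus_inner :: "(real ^ 'n \<Rightarrow> complex) \<Rightarrow> (real ^ 'n \<Rightarrow> complex) \<Rightarrow> complex" where
  "torus_inner v w = (\<integral>x. v x * cnj (w x) \<partial>torus_measure)"

definition ell2 :: "(int ^ 'n \<Rightarrow> complex) set" where
  "ell2 = {f. (\<lambda>k. (cmod (f k))\<^sup>2) summable_on UNIV}"

definition ell2_norm :: "(int ^ 'n \<Rightarrow> complex) \<Rightarrow> real" where
  "ell2_norm f = sqrt (\<Sum>\<^sub>\<infinity>k. (cmod (f k))\<^sup>2)"

definition bounded_operator_ell2 :: "((int ^ 'n \<Rightarrow> complex) \<Rightarrow> int ^ 'n \<Rightarrow> complex) \<Rightarrow> bool" where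
  "bounded_operator_ell2 A \<longleftrightarrow>
     (\<forall>f\<in>ell2. A f \<in> ell2) \<and>
     (\<forall>f\<in>ell2. \<forall>g\<in>ell2. A (\<lambda>k. f k + g k) = (\<lambda>k. A f k + A g k)) \<and>
     (\<forall>c. \<forall>f\<in>ell2. A (\<lambda>k. c * f k) = (\<lambda>k. c * A f k)) \<and>
     (\<exists>B. \<forall>f\<in>ell2. ell2_norm (A f) \<le> B * ell2_norm f)"

section \<open>Fourier transforms and Fourier series operators\<close>

definition F_lattice :: "(int ^ 'n \<Rightarrow> complex) \<Rightarrow> real ^ 'n \<Rightarrow> complex" where
  "F_lattice f x = (\<Sum>\<^sub>\<infinity>k. exp (- 2 * pi * \<i> * of_real (lat k \<bullet> x)) * f k)"

definition F_lattice_inv :: "(real ^ 'n \<Rightarrow> complex) \<Rightarrow> int ^ 'n \<Rightarrow> complex" where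
  "F_lattice_inv v k = (\<integral>x. exp (2 * pi * \<i> * of_real (lat k \<bullet> x)) * v x \<partial>torus_measure)"

definition F_torus :: "(real ^ 'n \<Rightarrow> complex) \<Rightarrow> int ^ 'n \<Rightarrow> complex" where
  "F_torus v k = (\<integral>x. exp (- 2 * pi * \<i> * of_real (x \<bullet> lat k)) * v x \<partial>torus_measure)"

definition T_lattice ::
  "(int ^ 'n \<Rightarrow> real ^ 'n \<Rightarrow> real) \<Rightarrow> (int ^ 'n \<Rightarrow> real ^ 'n \<Rightarrow> complex) \<Rightarrow>
   (int ^ 'n \<Rightarrow> complex) \<Rightarrow> int ^ 'n \<Rightarrow> complex" where
  "T_lattice \<phi> \<sigma> f k =
     (\<integral>x. exp (\<i> * of_real (\<phi> k x)) * \<sigma> k x * F_lattice f x \<partial>torus_measure)"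

definition T_torus ::
  "(real ^ 'n \<Rightarrow> int ^ 'n \<Rightarrow> real) \<Rightarrow> (real ^ 'n \<Rightarrow> int ^ 'n \<Rightarrow> complex) \<Rightarrow>
   (real ^ 'n \<Rightarrow> complex) \<Rightarrow> real ^ 'n \<Rightarrow> complex" where
  "T_torus \<psi> \<tau> v x = (\<Sum>\<^sub>\<infinity>k. exp (\<i> * of_real (\<psi> x k)) * \<tau> x k * F_torus v k)"

text \<open>\<open>T_torus \<psi> \<tau>\<close> is a well-defined operator from \<open>C\<^sup>\<infinity>\<close> to \<open>L\<^sup>2\<close> of the torus, its series
  converging absolutely almost everywhere and dominated in \<open>L\<^sup>2\<close>. (For example: whenever the
  \<open>L\<^sup>2\<close> norms of \<open>x \<mapsto> \<tau> x k\<close> grow at most polynomially in \<open>k\<close>.)\<close>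

definition T_torus_into_L2 ::
  "(real ^ 'n \<Rightarrow> int ^ 'n \<Rightarrow> real) \<Rightarrow> (real ^ 'n \<Rightarrow> int ^ 'n \<Rightarrow> complex) \<Rightarrow> bool" where
  "T_torus_into_L2 \<psi> \<tau> \<longleftrightarrow> (\<forall>v\<in>smooth_torus.
     T_torus \<psi> \<tau> v \<in> L2_torus \<and>
     (AE x in torus_measure. (\<lambda>k. cmod (\<tau> x k * F_torus v k)) summable_on UNIV) \<and>
     (\<lambda>x. of_real (\<Sum>\<^sub>\<infinity>k. cmod (\<tau> x k * F_torus v k))) \<in> L2_torus)"

section \<open>Adjoints with respect to the \<open>L\<^sup>2\<close> inner product on the torus\<close>

text \<open>The Hilbert space adjoint of a (possibly unbounded) operator \<open>T\<close> with the dense domain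
  \<open>C\<^sup>\<infinity>\<close>. It is given as a relation, its values being determined up to null sets:
  \<open>L2_adjoint T w u\<close> says that \<open>w\<close> is in the domain of \<open>T\<^sup>*\<close> and \<open>T\<^sup>* w = u\<close>.\<close>

definition L2_adjoint ::
  "((real ^ 'n \<Rightarrow> complex) \<Rightarrow> real ^ 'n \<Rightarrow> complex) \<Rightarrow>
   (real ^ 'n \<Rightarrow> complex) \<Rightarrow> (real ^ 'n \<Rightarrow> complex) \<Rightarrow> bool" where
  "L2_adjoint T w u \<longleftrightarrow> w \<in> L2_torus \<and> u \<in> L2_torus \<and>
     (\<forall>v\<in>smooth_torus. torus_inner (T v) w = torus_inner v u)"

text \<open>If \<open>w\<close> is not in the domain of the Hilbert space adjoint, \<open>T\<^sup>* w\<close> is still meaningful as a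
  generalised function: the conjugate-linear functional on \<open>C\<^sup>\<infinity>\<close> whose pairing with \<open>v\<close> extends
  \<open>torus_inner (T\<^sup>* w) v\<close>. For instance, for \<open>\<phi> = 0\<close> and \<open>\<sigma> = 1\<close> the operator \<open>T_torus\<close> is
  evaluation at \<open>0\<close>, and its adjoint produces multiples of the delta function.\<close>

definition formal_adjoint ::
  "((real ^ 'n \<Rightarrow> complex) \<Rightarrow> real ^ 'n \<Rightarrow> complex) \<Rightarrow>
   (real ^ 'n \<Rightarrow> complex) \<Rightarrow> (real ^ 'n \<Rightarrow> complex) \<Rightarrow> complex" where
  "formal_adjoint T w v = torus_inner w (T v)"

text \<open>The inverse lattice transform of such a functional; for the functional
  \<open>U = torus_inner u\<close> it is \<open>F_lattice_inv u\<close>, since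
  \<open>F_lattice_inv u k = torus_inner u (char (- k))\<close>.\<close>

definition F_lattice_inv_gen ::
  "((real ^ 'n \<Rightarrow> complex) \<Rightarrow> complex) \<Rightarrow> int ^ 'n \<Rightarrow> complex" where
  "F_lattice_inv_gen U k = U (char (- k))"

lemma F_lattice_inv_gen_torus_inner:
  fixes u :: "real ^ 'n \<Rightarrow> complex"
  shows "F_lattice_inv_gen (torus_inner u) = F_lattice_inv u"
proof
  fix k :: "int ^ 'n"
  have *: "cnj (char (- k) x) = exp (2 * pi * \<i> * of_real (lat k \<bullet> x))" for x
  proof -
    have "lat (- k) = - lat k"
      by (simp add: lat_def vec_eq_iff)
    then show ?thesis
      by (simp add: char_def exp_cnj)
  qed
  then show "F_lattice_inv_gen (torus_inner u) k = F_lattice_inv u k"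
    unfolding F_lattice_inv_gen_def F_lattice_inv_def torus_inner_def * by (simp only: mult.commute)
qed

end

theory Submission
  imports Defs
begin

text \<open>
  (i) Since \<open>char (- k)\<close> has a single nonzero Fourier coefficient, \<open>T_torus \<psi> \<tau> (char (- k))\<close> is the
  complex conjugate of \<open>exp (\<i> \<phi> k x) \<sigma> k x\<close>, so pairing it with \<open>F_lattice f\<close> gives \<open>T_lattice \<phi> \<sigma> f k\<close>.
  Conversely, if these numbers are square summable, the Riesz--Fischer theorem yields a function
  whose pairing with smooth \<open>v\<close> is computed by Parseval's formula; the domination hypothesis on the
  series of \<open>T_torus \<psi> \<tau> v\<close> permits integrating it termwise.

  (ii) The rows of the matrix of \<open>T_lattice \<phi> \<sigma>\<close> are the Fourier coefficients of the functions
  \<open>s k x = exp (\<i> \<phi> k x) \<sigma> k x\<close>. The phase \<open>\<phi> k - \<phi> l\<close> has gradient of size comparable to \<open>\<bar>k - l\<bar>\<close> and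
  higher derivatives of at most that size, so integrating by parts \<open>2n\<close> times gives
  \<open>\<bar>\<langle>s k, s l\<rangle>\<bar> \<le> C (1 + \<bar>k - l\<bar>)\<^sup>-\<^sup>2\<^sup>n\<close>. By Schur's test the map \<open>c \<mapsto> \<Sum> c k \<cdot> s k\<close> is
  bounded from \<open>\<ell>\<^sup>2\<close> to \<open>L\<^sup>2\<close>, and the boundedness of the operator follows by duality and
  Bessel's inequality.
\<close>

section \<open>Fourier coefficients on the torus\<close>

text \<open>What shapes (i) is that the adjoint of \<open>T_torus \<psi> \<tau>\<close> may be
  unbounded. As an identity between generalised functions the claim is algebra at each
  \<open>k\<close>; square summability of \<open>T_lattice \<phi> \<sigma> f\<close> decides whether
  \<open>F_lattice f\<close> lies in the domain of the Hilbert space adjoint. What shapes (ii) is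
  that \<open>\<phi> k\<close> itself is neither periodic nor controlled beyond one derivative; only
  its lattice differences are. The inner product of \<open>s k\<close> and \<open>s l\<close> sees
  only \<open>\<phi> k - \<phi> l\<close>, whose gradient telescopes along a lattice path. Divided
  by |k - l| it has 2n bounded derivatives and length bounded below, uniformly in the pair, as
  Schur's test demands. Of the 2n + 1 derivatives of \<open>Delta j \<phi> k\<close> one is spent on
  the gradient and 2n on the integrations by parts. The power 2n comes from (1 + |k|)^(-2n) being at
  most the product of the (1 + |k_i|)^(-2), whose lattice sum factorises. Derivatives of top order
  are bounded but possibly discontinuous, so integration by parts rests on difference
  quotients.\<close>

lemma lat_axis: "lat (axis i 1 :: int ^ 'n) = axis i 1"
  by (simp add: lat_def vec_eq_iff axis_def)

lemma lat_diff: "lat (k - l) = lat k - lat l"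
  by (simp add: lat_def vec_eq_iff)

lemma lat_uminus: "lat (- k) = - lat k"
  by (simp add: lat_def vec_eq_iff)

lemma lat_zero: "lat 0 = 0"
  by (simp add: lat_def vec_eq_iff)

section \<open>The torus as a probability space, and its translation invariance\<close>

lemma sets_unit_cube [measurable]: "unit_cube \<in> sets lebesgue"
  by (simp add: unit_cube_def)

lemma measure_torus: "measure torus_measure (space (torus_measure :: (real ^ 'n) measure)) = 1"
proof -
  have "measure lborel (cbox (0 :: real ^ 'n) (\<chi> i. 1)) = 1"
    by (subst content_cbox_cart) (auto simp: interval_eq_empty_cart)
  then show ?thesis
    by (simp add: torus_measure_def measure_restrict_space unit_cube_def)
qed

lemma finite_measure_torus: "finite_measure (torus_measure :: (real ^ 'n) measure)"
  unfolding torus_measure_def unit_cube_def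
  by (intro finite_measure_lebesgue_on) auto

lemma borel_measurable_torus:
  fixes f :: "real ^ 'n \<Rightarrow> 'b::topological_space"
  assumes "continuous_on UNIV f"
  shows "f \<in> borel_measurable torus_measure"
  unfolding torus_measure_def
  by (rule continuous_imp_measurable_on_sets_lebesgue) (auto intro: continuous_on_subset[OF assms])

lemma integrable_torus_bounded:
  fixes f :: "real ^ 'n \<Rightarrow> 'b::{banach, second_countable_topology}"
  assumes "f \<in> borel_measurable torus_measure" "\<And>x. norm (f x) \<le> B"
  shows "integrable torus_measure f"
  using finite_measure.integrable_const_bound[OF finite_measure_torus, of f B] assms by simp

text \<open>The total mass is 1. A non-integrable \<open>f\<close> has integral 0 by convention, and
  \<open>B\<close> is nonnegative because it bounds a norm, so the estimate can be used without
  checking measurability.\<close>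

lemma norm_integral_torus_le:
  fixes f :: "real ^ 'n \<Rightarrow> 'b::{banach, second_countable_topology}"
  assumes "\<And>x. norm (f x) \<le> B"
  shows "norm (\<integral>x. f x \<partial>torus_measure) \<le> B"
proof (cases "integrable torus_measure f")
  case True
  have "norm (\<integral>x. f x \<partial>torus_measure) \<le> (\<integral>x. norm (f x) \<partial>torus_measure)"
    by (rule integral_norm_bound)
  also have "\<dots> \<le> (\<integral>x. B \<partial>(torus_measure :: (real ^ 'n) measure))"
    using True assms finite_measure.integrable_const[OF finite_measure_torus]
    by (intro integral_mono) auto
  also have "\<dots> = B"
    by (simp add: measure_torus)
  finally show ?thesis .
next
  case False
  then show ?thesis
    using order_trans[OF norm_ge_zero assms] by (simp add: not_integrable_integral_eq)
qed

lemma integral_torus_eq_integral: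
  fixes g :: "real ^ 'n \<Rightarrow> complex"
  assumes "continuous_on UNIV g"
  shows "integral\<^sup>L torus_measure g = integral unit_cube g"
  unfolding torus_measure_def unit_cube_def
  using assms by (intro lebesgue_integral_eq_integral continuous_imp_integrable)
    (auto intro: continuous_on_subset)

text \<open>Cut and paste: the shifted cube is cut along the hyperplane where coordinate
  \<open>i\<close> equals 1, and the slab beyond it is moved back by one period, where it fills the
  slab that the shift had uncovered.\<close>

lemma integral_torus_shift:
  fixes g :: "real ^ 'n \<Rightarrow> complex"
  assumes g: "continuous_on UNIV g" "periodic g" and h: "0 < h" "h < 1"
  shows "(\<integral>x. g (x + h *\<^sub>R axis i 1) \<partial>torus_measure) = integral\<^sup>L torus_measure g"
proof -
  define E :: "real ^ 'n" where "E = axis i 1"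
  define one :: "real ^ 'n" where "one = (\<chi> i. 1)"
  define b :: "real ^ 'n" where "b = (\<chi> j. if j = i then 1 + h else 1)"
  have E: "E \<in> Basis"
    by (simp add: E_def)
  have xE: "x \<bullet> E = x $ i" for x
    by (simp add: E_def inner_axis)
  have En: "E $ j = (if j = i then 1 else 0)" for j
    by (simp add: E_def axis_def)
  have int: "g integrable_on cbox u v" for u v
    by (rule integrable_continuous) (use g in \<open>auto intro: continuous_on_subset\<close>)
  have gE: "g (x + E) = g x" for x
    using g(2) lat_axis[of i] by (metis E_def periodic_def)
  have "(\<integral>x. g (x + h *\<^sub>R axis i 1) \<partial>torus_measure) = integral unit_cube (\<lambda>x. g (x + h *\<^sub>R E))"
    unfolding E_def by (rule integral_torus_eq_integral)
      (intro continuous_on_compose2[OF g(1)] continuous_intros, auto)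
  also have "\<dots> = integral (cbox (h *\<^sub>R E) (one + h *\<^sub>R E)) g"
    using integral_shift_cbox[of "h *\<^sub>R E" "h *\<^sub>R E" "one + h *\<^sub>R E" g]
    by (simp add: unit_cube_def one_def)
  also have "\<dots> = integral (cbox (h *\<^sub>R E) (one + h *\<^sub>R E) \<inter> {x. x \<bullet> E \<le> 1}) g +
      integral (cbox (h *\<^sub>R E) (one + h *\<^sub>R E) \<inter> {x. 1 \<le> x \<bullet> E}) g"
    by (rule integral_split[OF int E])
  also have "cbox (h *\<^sub>R E) (one + h *\<^sub>R E) \<inter> {x. x \<bullet> E \<le> 1} = unit_cube \<inter> {x. h \<le> x \<bullet> E}"
    using h by (auto simp: mem_box_cart xE En one_def unit_cube_def split: if_splits)
       (smt (verit, ccfv_SIG))+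
  also have "cbox (h *\<^sub>R E) (one + h *\<^sub>R E) \<inter> {x. 1 \<le> x \<bullet> E} = cbox E b"
    using h by (auto simp: mem_box_cart xE En one_def b_def split: if_splits)
       (smt (verit, ccfv_SIG))+
  also have "integral (cbox E b) g = integral (cbox (E - E) (b - E)) g"
    using integral_shift_cbox[of E E b g] by (simp add: gE)
  also have "cbox (E - E) (b - E) = unit_cube \<inter> {x. x \<bullet> E \<le> h}"
    using h by (auto simp: mem_box_cart xE En b_def unit_cube_def split: if_splits)
       (smt (verit, ccfv_SIG))+
  also have "integral (unit_cube \<inter> {x. h \<le> x \<bullet> E}) g + integral (unit_cube \<inter> {x. x \<bullet> E \<le> h}) g
      = integral unit_cube g"
    unfolding unit_cube_def by (subst integral_split[OF int E, of _ _ h]) simp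
  also have "\<dots> = integral\<^sup>L torus_measure g"
    by (rule integral_torus_eq_integral[OF g(1), symmetric])
  finally show ?thesis .
qed

lemma pderiv_dir_has_vector_derivative:
  assumes "(f has_derivative f') (at (x + s *\<^sub>R axis i 1))"
  shows "((\<lambda>t. f (x + t *\<^sub>R axis i 1)) has_vector_derivative f' (axis i 1)) (at s)"
proof -
  have "((\<lambda>t. x + t *\<^sub>R axis i 1) has_derivative (\<lambda>t. t *\<^sub>R axis i 1)) (at s)"
    by (rule derivative_eq_intros refl | simp)+
  from has_derivative_compose[OF this assms]
  show ?thesis
    using linear_cmul[OF has_derivative_linear[OF assms]]
    by (simp add: has_vector_derivative_def)
qed

lemma pderiv_dir_eq:
  assumes "(f has_derivative f') (at x)"
  shows "pderiv_dir i f x = f' (axis i 1)"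
  unfolding pderiv_dir_def
  using pderiv_dir_has_vector_derivative[of f f' x 0 i] assms by (simp add: vector_derivative_at)

section \<open>Characters: periodicity, orthogonality, smoothness\<close>

lemma char_conv_cis: "char k x = cis (2 * pi * (lat k \<bullet> x))"
  by (simp add: char_def cis_conv_exp mult_ac)

lemma norm_char [simp]: "cmod (char k x) = 1"
  by (simp add: char_conv_cis)

lemma char_zero: "char 0 x = 1"
  by (simp add: char_conv_cis lat_zero)

lemma cnj_char: "cnj (char k x) = char (- k) x"
  by (simp add: char_conv_cis cis_cnj lat_uminus)

lemma char_mult_cnj: "char k x * cnj (char l x) = char (k - l) x"
  by (simp add: char_conv_cis cis_cnj cis_mult lat_diff inner_diff_left algebra_simps)

lemma exp_eq_char_uminus:
  "exp (- 2 * pi * \<i> * of_real (lat k \<bullet> x)) = char (- k) x"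
  "exp (- 2 * pi * \<i> * of_real (x \<bullet> lat k)) = char (- k) x"
  by (simp_all add: char_def lat_uminus inner_commute)

lemma char_add_axis: "char k (x + h *\<^sub>R axis i 1) = cis (2 * pi * of_int (k $ i) * h) * char k x"
proof -
  have "lat k \<bullet> (x + h *\<^sub>R axis i 1) = of_int (k $ i) * h + lat k \<bullet> x"
    by (simp add: inner_add_right inner_axis lat_def)
  then show ?thesis
    by (simp only: char_conv_cis cis_mult) (simp add: algebra_simps)
qed

lemma lat_inner_lat: "lat k \<bullet> lat l = of_int (\<Sum>i\<in>UNIV. k $ i * l $ i)"
  by (simp add: lat_def inner_vec_def)

lemma char_add_lat: "char k (x + lat m) = char k x"
proof -
  have "char k (x + lat m) = cis (2 * pi * (lat k \<bullet> x)) * cis (2 * pi * (lat k \<bullet> lat m))"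
    by (simp add: char_conv_cis cis_mult inner_add_right algebra_simps)
  also have "cis (2 * pi * (lat k \<bullet> lat m)) = 1"
    unfolding lat_inner_lat by (rule cis_multiple_2pi) auto
  finally show ?thesis
    by (simp add: char_conv_cis)
qed

lemma periodic_char: "periodic (char k)"
  by (simp add: periodic_def char_add_lat)

lemma continuous_char: "continuous_on UNIV (char k)"
  unfolding char_def by (intro continuous_intros)

text \<open>In a coordinate with \<open>k $ i \<noteq> 0\<close> a shift by half the period 1 /
  |k_i| changes the sign of the character, so by translation invariance the integral is its own
  negative. The shift is below 1 because |k_i| is at least 1.\<close>

lemma integral_char: "integral\<^sup>L torus_measure (char k) = (if k = 0 then 1 else 0)"
proof (cases "k = 0")
  case True
  have "char 0 = (\<lambda>x :: real ^ 'a. 1)"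
    by (simp add: fun_eq_iff char_zero)
  then show ?thesis
    using True by (simp add: measure_torus)
next
  case False
  then obtain i where i: "k $ i \<noteq> 0"
    by (auto simp: vec_eq_iff)
  define h :: real where "h = 1 / (2 * \<bar>of_int (k $ i)\<bar>)"
  have "\<bar>of_int (k $ i)\<bar> \<ge> (1 :: real)"
    using i by linarith
  then have h: "0 < h" "h < 1"
    by (auto simp: h_def field_simps)
  have "cis (2 * pi * of_int (k $ i) * h) = -1"
    using i by (cases "k $ i > 0") (auto simp: h_def cis.code complex_eq_iff)
  then have "char k (x + h *\<^sub>R axis i 1) = - char k x" for x
    by (simp add: char_add_axis)
  then have "- integral\<^sup>L torus_measure (char k) = integral\<^sup>L torus_measure (char k)"
    using integral_torus_shift[OF continuous_char periodic_char h, of k i] by simp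
  then show ?thesis
    using False by (simp add: complex_eq_iff)
qed

lemma smooth_char: "char k \<in> smooth_torus"
proof -
  have der: "((\<lambda>x. c * char k x) has_derivative
      (\<lambda>y. c * (char k x * (2 * pi * \<i> * of_real (lat k \<bullet> y))))) (at x)" for c x
    unfolding char_def
    by (rule derivative_eq_intros DERIV_exp[THEN has_field_derivative_imp_has_derivative,
          THEN has_derivative_compose[rotated]] refl | simp add: mult_ac)+
  have pd: "pderiv_dir i (\<lambda>x. c * char k x) = (\<lambda>x. (c * (2 * pi * \<i> * of_int (k $ i))) * char k x)"
    for c i
    by (simp add: fun_eq_iff pderiv_dir_eq[OF der] inner_axis lat_def)
  \<comment> \<open>The scalar \<open>c\<close> is generalised since each differentiation multiplies
    it by a constant and leaves the character unchanged.\<close>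
  have "times_differentiable m (\<lambda>x. c * char k x)" for m c
  proof (induction m arbitrary: c)
    case (Suc m)
    have "(\<lambda>x. c * char k x) differentiable (at x)" for x
      using der[of c x] unfolding differentiable_def by blast
    then show ?case
      using Suc unfolding times_differentiable.simps pd by blast
  qed simp
  from this[of _ 1] show ?thesis
    by (simp add: smooth_torus_def periodic_char)
qed

text \<open>Valid for arbitrary functions: if the product is not integrable, both sides are 0. Thus
  (i) can conjugate pairings whose integrands may fail to be measurable.\<close>

lemma cnj_torus_inner: "cnj (torus_inner v w) = torus_inner w v"
proof -
  have "torus_inner w v = (\<integral>x. cnj (v x * cnj (w x)) \<partial>torus_measure)"
    by (simp add: torus_inner_def mult.commute)
  also have "\<dots> = cnj (torus_inner v w)"
    unfolding torus_inner_def by (rule Bochner_Integration.integral_cnj)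
  finally show ?thesis ..
qed

lemma F_torus_conv_inner: "F_torus v k = torus_inner v (char k)"
  unfolding F_torus_def torus_inner_def exp_eq_char_uminus cnj_char by (simp add: mult.commute)

lemma F_torus_char: "F_torus (char k) l = (if l = k then 1 else 0)"
  unfolding F_torus_conv_inner torus_inner_def char_mult_cnj integral_char by auto

section \<open>Trigonometric polynomials and Bessel's inequality\<close>

definition trig_poly :: "(int ^ 'n) set \<Rightarrow> (int ^ 'n \<Rightarrow> complex) \<Rightarrow> real ^ 'n \<Rightarrow> complex" where
  "trig_poly G c x = (\<Sum>k\<in>G. c k * char k x)"

lemma continuous_trig_poly: "continuous_on UNIV (trig_poly G c)"
  unfolding trig_poly_def by (intro continuous_intros continuous_char)

lemma norm_trig_poly_le: "cmod (trig_poly G c x) \<le> (\<Sum>k\<in>G. cmod (c k))"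
  unfolding trig_poly_def by (rule order_trans[OF norm_sum]) (simp add: norm_mult)

lemma integrable_trig_poly: "integrable torus_measure (trig_poly G c)"
  by (rule integrable_torus_bounded[OF borel_measurable_torus[OF continuous_trig_poly] norm_trig_poly_le])

lemma borel_measurable_cnj:
  "f \<in> borel_measurable M \<Longrightarrow> (\<lambda>x. cnj (f x)) \<in> borel_measurable M"
  by (rule measurable_compose[OF _ borel_measurable_continuous_onI]) (auto intro: continuous_intros)

lemma integrable_mult_bounded:
  fixes v w :: "real ^ 'n \<Rightarrow> complex"
  assumes "integrable torus_measure v" "w \<in> borel_measurable torus_measure" "\<And>x. cmod (w x) \<le> B"
  shows "integrable torus_measure (\<lambda>x. v x * w x)"
proof (rule Bochner_Integration.integrable_bound)
  show "integrable torus_measure (\<lambda>x. of_real B * v x)"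
    using assms by simp
  have "cmod (v x * w x) \<le> cmod (of_real B * v x)" for x
  proof -
    have "cmod (v x * w x) \<le> cmod (v x) * B"
      unfolding norm_mult by (intro mult_left_mono assms) auto
    also have "\<dots> \<le> cmod (v x) * \<bar>B\<bar>"
      by (intro mult_left_mono) auto
    finally show ?thesis
      by (simp add: norm_mult mult.commute)
  qed
  then show "AE x in torus_measure. cmod (v x * w x) \<le> cmod (of_real B * v x)"
    by simp
qed (use assms in measurable)

lemma torus_inner_trig_poly:
  assumes "integrable torus_measure v"
  shows "torus_inner v (trig_poly G c) = (\<Sum>k\<in>G. F_torus v k * cnj (c k))"
proof -
  have "integrable torus_measure (\<lambda>x. v x * cnj (char k x))" for k
    by (rule integrable_mult_bounded[OF assms, of _ 1])
       (auto simp: cnj_char intro!: borel_measurable_torus continuous_char)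
  then have int: "integrable torus_measure (\<lambda>x. cnj (c k) * (v x * cnj (char k x)))" for k
    by simp
  have "torus_inner v (trig_poly G c) = (\<integral>x. (\<Sum>k\<in>G. cnj (c k) * (v x * cnj (char k x))) \<partial>torus_measure)"
    unfolding torus_inner_def trig_poly_def by (simp add: sum_distrib_left mult_ac)
  also have "\<dots> = (\<Sum>k\<in>G. F_torus v k * cnj (c k))"
    unfolding F_torus_conv_inner torus_inner_def
    by (subst Bochner_Integration.integral_sum[OF int]) (simp add: mult.commute)
  finally show ?thesis .
qed

lemma F_torus_trig_poly:
  assumes "finite G"
  shows "F_torus (trig_poly G c) k = (if k \<in> G then c k else 0)"
proof -
  have "cnj (F_torus (trig_poly G c) k) = torus_inner (char k) (trig_poly G c)"
    unfolding F_torus_conv_inner by (rule cnj_torus_inner)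
  also have "\<dots> = (\<Sum>l\<in>G. if l = k then cnj (c l) else 0)"
    by (subst torus_inner_trig_poly)
       (auto intro!: integrable_torus_bounded[of _ 1] borel_measurable_torus continuous_char
         sum.cong simp: F_torus_char)
  also have "\<dots> = (if k \<in> G then cnj (c k) else 0)"
    using assms by simp
  finally show ?thesis
    by (metis complex_cnj_cnj complex_cnj_zero)
qed

lemma integral_norm_trig_poly:
  assumes "finite G"
  shows "(\<integral>x. (cmod (trig_poly G c x))\<^sup>2 \<partial>torus_measure) = (\<Sum>k\<in>G. (cmod (c k))\<^sup>2)"
proof -
  have "complex_of_real (\<integral>x. (cmod (trig_poly G c x))\<^sup>2 \<partial>torus_measure) =
      torus_inner (trig_poly G c) (trig_poly G c)"
    unfolding torus_inner_def complex_norm_square[symmetric] by (simp flip: integral_complex_of_real)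
  also have "\<dots> = (\<Sum>k\<in>G. complex_of_real ((cmod (c k))\<^sup>2))"
    by (subst torus_inner_trig_poly[OF integrable_trig_poly], rule sum.cong)
       (use assms in \<open>auto simp: F_torus_trig_poly complex_norm_square simp del: of_real_power\<close>)
  finally show ?thesis
    by (metis of_real_eq_iff of_real_sum)
qed

text \<open>On a probability space t \<le> 1 + t^2 places L^2 inside L^1.\<close>

lemma integrable_of_square:
  fixes v :: "real ^ 'n \<Rightarrow> complex"
  assumes "v \<in> borel_measurable torus_measure" "integrable torus_measure (\<lambda>x. (cmod (v x))\<^sup>2)"
  shows "integrable torus_measure v"
proof (rule Bochner_Integration.integrable_bound)
  show "integrable torus_measure (\<lambda>x. 1 + (cmod (v x))\<^sup>2)"
    by (intro Bochner_Integration.integrable_add assms finite_measure.integrable_const[OF finite_measure_torus])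
  have "cmod (v x) \<le> norm (1 + (cmod (v x))\<^sup>2)" for x
    using sum_squares_bound[of "cmod (v x)" 1] by (simp add: add.commute)
       (smt (verit) zero_le_power2)
  then show "AE x in torus_measure. cmod (v x) \<le> norm (1 + (cmod (v x))\<^sup>2)"
    by simp
qed fact

text \<open>Expand the nonnegative integral of |v - p|^2, where \<open>p\<close> is the part of the
  Fourier series of \<open>v\<close> over \<open>G\<close>: both the pairing of \<open>v\<close>
  with \<open>p\<close> and the squared norm of \<open>p\<close> equal the sum of the squared
  coefficients.\<close>

lemma Bessel:
  assumes v: "v \<in> borel_measurable torus_measure" "integrable torus_measure (\<lambda>x. (cmod (v x))\<^sup>2)"
    and G: "finite G"
  shows "(\<Sum>k\<in>G. (cmod (F_torus v k))\<^sup>2) \<le> (\<integral>x. (cmod (v x))\<^sup>2 \<partial>torus_measure)"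
proof -
  define p where "p = trig_poly G (F_torus v)"
  note iv = integrable_of_square[OF v]
  have p: "p \<in> borel_measurable torus_measure"
    unfolding p_def by (intro borel_measurable_torus continuous_trig_poly)
  have pb: "cmod (p x) \<le> (\<Sum>k\<in>G. cmod (F_torus v k))" for x
    unfolding p_def by (rule norm_trig_poly_le)
  have ip: "integrable torus_measure (\<lambda>x. (cmod (p x))\<^sup>2)"
    using pb by (intro integrable_torus_bounded[where B = "(\<Sum>k\<in>G. cmod (F_torus v k))\<^sup>2"])
       (use p in \<open>auto intro!: power_mono\<close>)
  have ivp: "integrable torus_measure (\<lambda>x. v x * cnj (p x))"
    using pb p by (intro integrable_mult_bounded[OF iv, where B = "\<Sum>k\<in>G. cmod (F_torus v k)"])
      (auto intro: borel_measurable_cnj)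
  have eq: "(cmod (v x - p x))\<^sup>2 = (cmod (v x))\<^sup>2 - 2 * Re (v x * cnj (p x)) + (cmod (p x))\<^sup>2" for x
    by (simp only: cmod_power2) (simp add: power2_eq_square algebra_simps)
  have "0 \<le> (\<integral>x. (cmod (v x - p x))\<^sup>2 \<partial>torus_measure)"
    by simp
  also have "\<dots> = (\<integral>x. (cmod (v x))\<^sup>2 \<partial>torus_measure) - 2 * Re (torus_inner v p) +
      (\<integral>x. (cmod (p x))\<^sup>2 \<partial>torus_measure)"
    unfolding eq torus_inner_def
    by (subst integral_Re[symmetric, OF ivp])
       (use v(2) ip integrable_Re[OF ivp] in \<open>simp del: times_complex.sel\<close>)
  also have "Re (torus_inner v p) = (\<Sum>k\<in>G. (cmod (F_torus v k))\<^sup>2)"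
    unfolding p_def torus_inner_trig_poly[OF iv] complex_norm_square[symmetric] by simp
  also have "(\<integral>x. (cmod (p x))\<^sup>2 \<partial>torus_measure) = (\<Sum>k\<in>G. (cmod (F_torus v k))\<^sup>2)"
    unfolding p_def by (rule integral_norm_trig_poly[OF G])
  finally show ?thesis
    by simp
qed

lemma Bessel_ell2:
  assumes "v \<in> borel_measurable torus_measure" "integrable torus_measure (\<lambda>x. (cmod (v x))\<^sup>2)"
  shows "F_torus v \<in> ell2"
    and "(\<Sum>\<^sub>\<infinity>k. (cmod (F_torus v k))\<^sup>2) \<le> (\<integral>x. (cmod (v x))\<^sup>2 \<partial>torus_measure)"
proof -
  show "F_torus v \<in> ell2"
    unfolding ell2_def mem_Collect_eq
    by (rule nonneg_bdd_above_summable_on) (auto intro!: bdd_aboveI2 Bessel[OF assms])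
  then show "(\<Sum>\<^sub>\<infinity>k. (cmod (F_torus v k))\<^sup>2) \<le> (\<integral>x. (cmod (v x))\<^sup>2 \<partial>torus_measure)"
    by (intro infsum_le_finite_sums Bessel[OF assms]) (simp_all add: ell2_def)
qed

section \<open>Summation over the lattice\<close>

lemma ex_add_lat_in_cube: "\<exists>m. x + lat m \<in> unit_cube"
proof
  show "x + lat (\<chi> i. - \<lfloor>x $ i\<rfloor>) \<in> unit_cube"
    by (auto simp: unit_cube_def mem_box_cart lat_def) linarith+
qed

lemma bounded_continuous_periodic:
  fixes v :: "real ^ 'n \<Rightarrow> 'b::real_normed_vector"
  assumes "continuous_on UNIV v" "periodic v"
  obtains B where "\<And>x. norm (v x) \<le> B"
proof -
  have "compact (v ` unit_cube)"
    unfolding unit_cube_def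
    by (intro compact_continuous_image continuous_on_subset[OF assms(1)]) auto
  then obtain B where B: "\<And>y. y \<in> unit_cube \<Longrightarrow> norm (v y) \<le> B"
    using compact_imp_bounded bounded_iff by (metis imageI)
  have "norm (v x) \<le> B" for x
    using ex_add_lat_in_cube[of x] B assms(2) unfolding periodic_def by metis
  then show ?thesis
    by (rule that)
qed

text \<open>Limit theorems for integrals speak about series indexed by \<open>nat\<close>; this
  bijection carries unordered sums over the lattice to them.\<close>

definition lattice_enum :: "nat \<Rightarrow> int ^ 'n" where
  "lattice_enum = from_nat_into UNIV"

lemma bij_lattice_enum: "bij (lattice_enum :: nat \<Rightarrow> int ^ 'n)"
proof -
  have "inj (\<lambda>i :: int. (\<chi> j. i) :: int ^ 'n)"
    by (auto simp: inj_def vec_eq_iff)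
  then have "infinite (UNIV :: (int ^ 'n) set)"
    using finite_imageD infinite_UNIV_int finite_subset subset_UNIV by metis
  then show ?thesis
    unfolding lattice_enum_def by (intro bij_betw_from_nat_into) auto
qed

lemma infsum_lattice_sums:
  fixes g :: "int ^ 'n \<Rightarrow> 'b::banach"
  assumes "(\<lambda>k. norm (g k)) summable_on UNIV"
  shows "(\<lambda>n. g (lattice_enum n)) sums (\<Sum>\<^sub>\<infinity>k. g k)"
    and "summable (\<lambda>n. norm (g (lattice_enum n)))"
proof -
  have "g summable_on UNIV"
    using assms by (rule abs_summable_summable)
  then have "((\<lambda>n. g (lattice_enum n)) has_sum (\<Sum>\<^sub>\<infinity>k. g k)) UNIV"
    using summable_on_reindex_bij_betw[OF bij_lattice_enum, of g]
      infsum_reindex_bij_betw[OF bij_lattice_enum, of g] by (metis has_sum_infsum)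
  then show "(\<lambda>n. g (lattice_enum n)) sums (\<Sum>\<^sub>\<infinity>k. g k)"
    by (rule has_sum_imp_sums)
  have "(\<lambda>n. norm (g (lattice_enum n))) summable_on UNIV"
    using assms summable_on_reindex_bij_betw[OF bij_lattice_enum, of "\<lambda>k. norm (g k)"] by simp
  then show "summable (\<lambda>n. norm (g (lattice_enum n)))"
    by (rule summable_on_imp_summable)
qed

lemma infsum_sum:
  fixes f :: "'b \<Rightarrow> 'a \<Rightarrow> 'c::{topological_comm_monoid_add, t2_space}"
  assumes "\<And>j. j \<in> F \<Longrightarrow> f j summable_on A"
  shows "(\<Sum>\<^sub>\<infinity>x\<in>A. \<Sum>j\<in>F. f j x) = (\<Sum>j\<in>F. infsum (f j) A)"
proof -
  have "((\<lambda>x. \<Sum>j\<in>F. f j x) has_sum (\<Sum>j\<in>F. infsum (f j) A)) A"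
    using assms
    by (induction F rule: infinite_finite_induct) (auto intro!: has_sum_add has_sum_infsum has_sum_0)
  then show ?thesis
    by (rule infsumI)
qed

text \<open>Along the enumeration this is termwise integration of an absolutely convergent series.
  The unordered sum agrees with that series only almost everywhere, so its measurability is a
  hypothesis of its own.\<close>

lemma integral_infsum_lattice:
  fixes g :: "int ^ 'n \<Rightarrow> 'a \<Rightarrow> complex"
  assumes int: "\<And>k. integrable M (g k)"
    and ae: "AE x in M. (\<lambda>k. cmod (g k x)) summable_on UNIV"
    and sm: "(\<lambda>k. \<integral>x. cmod (g k x) \<partial>M) summable_on UNIV"
    and meas: "(\<lambda>x. \<Sum>\<^sub>\<infinity>k. g k x) \<in> borel_measurable M"
  shows "(\<integral>x. (\<Sum>\<^sub>\<infinity>k. g k x) \<partial>M) = (\<Sum>\<^sub>\<infinity>k. \<integral>x. g k x \<partial>M)"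
proof -
  let ?h = "lattice_enum :: nat \<Rightarrow> int ^ 'n"
  have ae': "AE x in M. summable (\<lambda>n. norm (g (?h n) x))"
    using ae by eventually_elim (rule infsum_lattice_sums)
  have sm': "summable (\<lambda>n. \<integral>x. norm (g (?h n) x) \<partial>M)"
    using infsum_lattice_sums(2)[of "\<lambda>k. \<integral>x. cmod (g k x) \<partial>M"] sm by simp
  have "(\<integral>x. (\<Sum>\<^sub>\<infinity>k. g k x) \<partial>M) = (\<integral>x. (\<Sum>n. g (?h n) x) \<partial>M)"
  proof (rule integral_cong_AE[OF meas])
    show "(\<lambda>x. \<Sum>n. g (?h n) x) \<in> borel_measurable M"
      using int by (intro borel_measurable_suminf borel_measurable_integrable)
    show "AE x in M. (\<Sum>\<^sub>\<infinity>k. g k x) = (\<Sum>n. g (?h n) x)"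
      using ae by eventually_elim (rule sums_unique[OF infsum_lattice_sums(1)])
  qed
  moreover have "(\<lambda>n. \<integral>x. g (?h n) x \<partial>M) sums (\<integral>x. (\<Sum>n. g (?h n) x) \<partial>M)"
    by (rule sums_integral[OF int ae' sm'])
  moreover have "(\<lambda>k. cmod (\<integral>x. g k x \<partial>M)) summable_on UNIV"
    using sm by (rule summable_on_comparison_test) (auto intro: integral_norm_bound)
  then have "(\<lambda>n. \<integral>x. g (?h n) x \<partial>M) sums (\<Sum>\<^sub>\<infinity>k. \<integral>x. g k x \<partial>M)"
    by (rule infsum_lattice_sums)
  ultimately show ?thesis
    using sums_unique2 by metis
qed

text \<open>A majorant of (1 + |k|)^(-2n) in product form, so that its sum over a box is the n-th
  power of a one-dimensional sum. Positive and even, it is the weight in Schur's test.\<close>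

definition lattice_decay :: "int ^ 'n \<Rightarrow> real" where
  "lattice_decay k = (\<Prod>i\<in>UNIV. 1 / (1 + \<bar>of_int (k $ i)\<bar>)\<^sup>2)"

lemma lattice_decay_pos: "0 < lattice_decay k"
  unfolding lattice_decay_def by (intro prod_pos) (auto intro!: divide_pos_pos zero_less_power add_pos_nonneg)

lemma lattice_decay_uminus: "lattice_decay (- k) = lattice_decay k"
  by (simp add: lattice_decay_def)

lemma lattice_decay_commute: "lattice_decay (k - l) = lattice_decay (l - k)"
  using lattice_decay_uminus[of "l - k"] by simp

text \<open>The subtracted term makes the induction close: the two new summands add up to 2 / (M +
  2)^2, which is at most the telescoping difference 2 / (M + 1) - 2 / (M + 2).\<close>

lemma inverse_square_sum_le:
  "(\<Sum>j\<in>{- int M..int M}. 1 / (1 + \<bar>real_of_int j\<bar>)\<^sup>2) \<le> 4 - 2 / (real M + 1)"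
proof (induction M)
  case (Suc M)
  have "{- int (Suc M)..int (Suc M)} = insert (int M + 1) (insert (- int M - 1) {- int M..int M})"
    by auto
  then have "(\<Sum>j\<in>{- int (Suc M)..int (Suc M)}. 1 / (1 + \<bar>real_of_int j\<bar>)\<^sup>2) =
      2 / (real M + 2)\<^sup>2 + (\<Sum>j\<in>{- int M..int M}. 1 / (1 + \<bar>real_of_int j\<bar>)\<^sup>2)"
    by (simp add: abs_if algebra_simps)
  also have "2 / (real M + 2)\<^sup>2 \<le> 2 / (real M + 1) - 2 / (real M + 2)"
    by (simp add: divide_simps power2_eq_square)
  finally show ?case
    using Suc by (simp add: add_ac)
qed simp

lemma sum_lattice_decay_le:
  assumes "finite (F :: (int ^ 'n) set)"
  shows "sum lattice_decay F \<le> 4 ^ CARD('n)"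
proof -
  \<comment> \<open>Any common bound on all coordinates would do; a sum, unlike a maximum, needs no
    separate treatment of the empty set.\<close>
  define M where "M = (\<Sum>k\<in>F. \<Sum>i\<in>UNIV. nat \<bar>k $ i\<bar>)"
  have M: "k $ i \<in> {- int M..int M}" if "k \<in> F" for k i
  proof -
    have "nat \<bar>k $ i\<bar> \<le> (\<Sum>i\<in>UNIV. nat \<bar>k $ i\<bar>)"
      by (rule member_le_sum) auto
    also have "\<dots> \<le> M"
      unfolding M_def by (rule member_le_sum[OF that]) (use assms in auto)
    finally show ?thesis
      by auto
  qed
  let ?P = "PiE UNIV (\<lambda>_ :: 'n. {- int M..int M})"
  have "F \<subseteq> vec_lambda ` ?P"
  proof
    fix k assume "k \<in> F"
    then have "($) k \<in> ?P"
      using M by auto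
    then show "k \<in> vec_lambda ` ?P"
      by (metis image_eqI vec_nth_inverse)
  qed
  then have "sum lattice_decay F \<le> sum lattice_decay (vec_lambda ` ?P)"
    by (intro sum_mono2) (auto intro!: finite_PiE less_imp_le[OF lattice_decay_pos])
  also have "\<dots> = (\<Sum>g\<in>?P. \<Prod>i\<in>UNIV. 1 / (1 + \<bar>of_int (g i)\<bar>)\<^sup>2)"
    by (subst sum.reindex) (auto simp: inj_on_def lattice_decay_def vec_lambda_inject)
  also have "\<dots> = (\<Prod>i\<in>(UNIV :: 'n set). \<Sum>j\<in>{- int M..int M}. 1 / (1 + \<bar>real_of_int j\<bar>)\<^sup>2)"
    by (rule prod_sum_PiE[symmetric]) auto
  also have "\<dots> \<le> (\<Prod>i\<in>(UNIV :: 'n set). 4)"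
  proof (intro prod_mono conjI)
    show "(\<Sum>j\<in>{- int M..int M}. 1 / (1 + \<bar>real_of_int j\<bar>)\<^sup>2) \<le> 4"
      using inverse_square_sum_le[of M] by (smt (verit) divide_nonneg_nonneg of_nat_0_le_iff)
  qed (auto intro!: sum_nonneg)
  finally show ?thesis
    by simp
qed

lemma summable_lattice_decay: "lattice_decay summable_on UNIV"
  by (rule nonneg_bdd_above_summable_on)
     (auto intro!: bdd_aboveI2 sum_lattice_decay_le less_imp_le[OF lattice_decay_pos])

lemma inverse_norm_power_le_decay:
  "1 / (1 + norm (lat (k :: int ^ 'n))) ^ (2 * CARD('n)) \<le> lattice_decay k"
proof -
  have "1 / (1 + norm (lat k)) ^ (2 * CARD('n)) = (\<Prod>i\<in>(UNIV :: 'n set). 1 / (1 + norm (lat k))\<^sup>2)"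
    by (simp add: power_mult power_one_over)
  also have "\<dots> \<le> lattice_decay k"
    unfolding lattice_decay_def
  proof (intro prod_mono conjI)
    fix i
    have "\<bar>of_int (k $ i)\<bar> \<le> norm (lat k)"
      using component_le_norm_cart[of "lat k" i] by (simp add: lat_def)
    then show "1 / (1 + norm (lat k))\<^sup>2 \<le> 1 / (1 + \<bar>real_of_int (k $ i)\<bar>)\<^sup>2"
      by (intro divide_left_mono power_mono mult_pos_pos zero_less_power) auto
  qed auto
  finally show ?thesis .
qed

lemma schwartz_lattice_summable:
  fixes f :: "int ^ 'n \<Rightarrow> complex"
  assumes "f \<in> schwartz_lattice"
  shows "(\<lambda>k. cmod (f k)) summable_on UNIV"
proof -
  obtain C where C: "\<And>k. cmod (f k) \<le> C / (1 + norm (lat k)) ^ (2 * CARD('n))"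
    using assms unfolding schwartz_lattice_def by blast
  have "cmod (f k) \<le> \<bar>C\<bar> * lattice_decay k" for k
  proof -
    have "cmod (f k) \<le> \<bar>C\<bar> * (1 / (1 + norm (lat k)) ^ (2 * CARD('n)))"
      using order_trans[OF C[of k] divide_right_mono[OF abs_ge_self]] by simp
    also have "\<dots> \<le> \<bar>C\<bar> * lattice_decay k"
      by (intro mult_left_mono inverse_norm_power_le_decay) auto
    finally show ?thesis .
  qed
  then show ?thesis
    by (intro summable_on_comparison_test[OF summable_on_cmult_right[OF summable_lattice_decay]]) auto
qed

section \<open>Square-summable sequences, and the transform of rapidly decreasing ones\<close>

lemma ell2_mult_summable:
  assumes "a \<in> ell2" "b \<in> ell2"
  shows "(\<lambda>k. cmod (a k * b k)) summable_on UNIV"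
  using abs_summable_product[of a UNIV b] assms
  by (simp add: ell2_def norm_mult power2_eq_square)

lemma ell2_uminus:
  assumes "a \<in> ell2"
  shows "(\<lambda>k. a (- k)) \<in> ell2"
  using assms summable_on_reindex_bij_betw[of uminus UNIV UNIV "\<lambda>k. (cmod (a k))\<^sup>2"]
  by (simp add: ell2_def bij_uminus)

lemma F_lattice_conv_char: "F_lattice f x = (\<Sum>\<^sub>\<infinity>k. char (- k) x * f k)"
  unfolding F_lattice_def exp_eq_char_uminus ..

lemma F_lattice_inv_conv_F_torus: "F_lattice_inv u k = F_torus u (- k)"
  unfolding F_lattice_inv_def F_torus_def exp_eq_char_uminus by (simp add: char_def)

context
  fixes f :: "int ^ 'n \<Rightarrow> complex"
  assumes f: "f \<in> schwartz_lattice"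
begin

lemma F_lattice_summable: "(\<lambda>k. cmod (char (- k) x * f k)) summable_on UNIV"
  using schwartz_lattice_summable[OF f] by (simp add: norm_mult)

lemma norm_F_lattice_le: "cmod (F_lattice f x) \<le> (\<Sum>\<^sub>\<infinity>k. cmod (f k))"
  using norm_infsum_bound[OF F_lattice_summable[of x]] unfolding F_lattice_conv_char
  by (simp add: norm_mult)

lemma borel_measurable_F_lattice: "F_lattice f \<in> borel_measurable torus_measure"
proof -
  have "F_lattice f = (\<lambda>x. \<Sum>n. char (- lattice_enum n) x * f (lattice_enum n))"
    by (rule ext) (simp add: F_lattice_conv_char sums_unique[OF infsum_lattice_sums(1)[OF F_lattice_summable]])
  moreover have "(\<lambda>x :: real ^ 'n. char (- lattice_enum n) x * f (lattice_enum n)) \<in> borel_measurable torus_measure" for n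
    by (intro borel_measurable_torus continuous_intros continuous_char)
  ultimately show ?thesis
    by (simp add: borel_measurable_suminf)
qed

lemma F_lattice_L2: "F_lattice f \<in> L2_torus"
proof -
  have "periodic (F_lattice f)"
    by (simp add: F_lattice_conv_char periodic_def char_add_lat)
  moreover have "integrable torus_measure (\<lambda>x. (cmod (F_lattice f x))\<^sup>2)"
    by (rule integrable_torus_bounded[where B = "(\<Sum>\<^sub>\<infinity>k. cmod (f k))\<^sup>2"])
       (use borel_measurable_F_lattice norm_F_lattice_le in \<open>auto intro!: power_mono\<close>)
  ultimately show ?thesis
    unfolding L2_torus_def using borel_measurable_F_lattice by simp
qed

end

section \<open>The adjoint of the toroidal operator\<close>

text \<open>A sparse subsequence of the partial sums converges absolutely in L^1 and almost
  everywhere, and Fatou's lemma puts its limit into L^2. The pairing formula is stated for bounded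
  \<open>v\<close> because against these L^1 convergence suffices.\<close>

lemma Riesz_Fischer:
  fixes a :: "int ^ 'n \<Rightarrow> complex"
  assumes a: "a \<in> ell2"
  obtains u where "u \<in> L2_torus"
    and "\<And>v B. v \<in> borel_measurable torus_measure \<Longrightarrow> (\<And>x. cmod (v x) \<le> B) \<Longrightarrow>
      torus_inner v u = (\<Sum>\<^sub>\<infinity>k. F_torus v k * cnj (a k))"
proof -
  let ?h = "lattice_enum :: nat \<Rightarrow> int ^ 'n"
  define q where "q n = (cmod (a (?h n)))\<^sup>2" for n
  have sq: "summable q"
    using infsum_lattice_sums(2)[of "\<lambda>k. (cmod (a k))\<^sup>2"] a unfolding q_def ell2_def by simp
  have q0: "q n \<ge> 0" for n
    by (simp add: q_def)
  have "\<exists>M. \<forall>m\<ge>M. \<forall>n. norm (sum q {m..<n}) < (1/4) ^ j" for j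
    using sq unfolding summable_Cauchy by simp
  \<comment> \<open>The partial sums up to \<open>N j\<close> converge so fast that their differences \<open>D j\<close> are summable in \<open>L\<^sup>1\<close>,
    which gives convergence almost everywhere.\<close>
  then obtain M where M: "\<And>j m n. m \<ge> M j \<Longrightarrow> norm (sum q {m..<n}) < (1/4) ^ j"
    by metis
  \<comment> \<open>\<open>Suc\<close> makes \<open>N\<close> strictly increasing, and
    \<open>N (Suc j)\<close> exceeds \<open>M j\<close>. Hence the block \<open>D (Suc j)\<close>
    has squared L^2 norm at most (1/4)^j, and the square roots (1/2)^j are summable.\<close>
  define N where "N j = (\<Sum>i<j. Suc (M i))" for j
  have N: "strict_mono N"
    by (rule strict_monoI_Suc) (simp add: N_def)
  have tail: "sum q {N (Suc j)..<N (Suc (Suc j))} \<le> (1/4) ^ j" for j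
    using M[of j "N (Suc j)" "N (Suc (Suc j))"] by (auto simp: N_def)
  define P where "P J = trig_poly (?h ` {..<N J}) a" for J
  define D where "D j = trig_poly (?h ` {N j..<N (Suc j)}) a" for j
  have inj: "inj_on ?h A" for A
    using bij_lattice_enum by (meson bij_is_inj inj_on_subset subset_UNIV)
  have PD: "(\<Sum>j<J. D j x) = P J x" for J x
  proof (induction J)
    case 0
    then show ?case
      by (simp add: P_def N_def trig_poly_def)
  next
    case (Suc J)
    have "N J \<le> N (Suc J)"
      using strict_mono_mono[OF N] by (simp add: monoD)
    then have "P (Suc J) x = P J x + D J x"
      unfolding P_def D_def trig_poly_def sum.reindex[OF inj] lessThan_atLeast0
      by (simp add: sum.atLeastLessThan_concat)
    then show ?case
      using Suc by simp
  qed
  have Dm: "D j \<in> borel_measurable torus_measure" and Pm: "P j \<in> borel_measurable torus_measure" for j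
    unfolding D_def P_def by (intro borel_measurable_torus continuous_trig_poly)+
  have Di: "integrable torus_measure (D j)" for j
    unfolding D_def by (rule integrable_trig_poly)
  have D2i: "integrable torus_measure (\<lambda>x. (cmod (trig_poly G c x))\<^sup>2)" for G and c :: "int ^ 'n \<Rightarrow> complex"
    by (rule integrable_torus_bounded[where B = "(\<Sum>k\<in>G. cmod (c k))\<^sup>2"])
       (auto intro!: power_mono borel_measurable_torus continuous_intros continuous_trig_poly
         norm_trig_poly_le)
  \<comment> \<open>The block \<open>D 0\<close> has no such bound, so the comparison is made for
    the series shifted by one.\<close>
  have sD: "summable (\<lambda>j. \<integral>x. norm (D j x) \<partial>torus_measure)"
  proof (rule summable_Suc_iff[THEN iffD1], rule summable_comparison_test')
    show "summable (\<lambda>j. (1/2 :: real) ^ j)"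
      by (rule summable_geometric) simp
    fix j :: nat
    define e :: real where "e = (1/2) ^ j"
    have e: "e > 0" "(1/4) ^ j = e * e"
      by (simp_all add: e_def flip: power_mult_distrib)
    have int: "integrable torus_measure (\<lambda>x. (e + (cmod (D (Suc j) x))\<^sup>2 / e) / 2)"
      unfolding D_def
      by (intro integrable_divide Bochner_Integration.integrable_add D2i
          finite_measure.integrable_const[OF finite_measure_torus])
    \<comment> \<open>AM-GM bounds the \<open>L\<^sup>1\<close> norm by the \<open>L\<^sup>2\<close> norm\<close>
    have "norm (D (Suc j) x) \<le> (e + (cmod (D (Suc j) x))\<^sup>2 / e) / 2" for x
      using e(1) sum_squares_bound[of e "cmod (D (Suc j) x)"]
      by (simp add: field_simps power2_eq_square)
    then have "(\<integral>x. norm (D (Suc j) x) \<partial>torus_measure)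
        \<le> (\<integral>x. (e + (cmod (D (Suc j) x))\<^sup>2 / e) / 2 \<partial>torus_measure)"
      using Di[of "Suc j"] int by (intro integral_mono) auto
    also have "\<dots> = (e + (\<integral>x. (cmod (D (Suc j) x))\<^sup>2 \<partial>torus_measure) / e) / 2"
      unfolding D_def integral_divide_zero
      by (subst Bochner_Integration.integral_add)
         (auto simp: measure_torus intro!: integrable_divide D2i
           finite_measure.integrable_const[OF finite_measure_torus])
    also have "(\<integral>x. (cmod (D (Suc j) x))\<^sup>2 \<partial>torus_measure) = sum q {N (Suc j)..<N (Suc (Suc j))}"
      unfolding D_def by (subst integral_norm_trig_poly) (auto simp: sum.reindex[OF inj] q_def)
    also have "(e + sum q {N (Suc j)..<N (Suc (Suc j))} / e) / 2 \<le> e"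
      using tail[of j, unfolded e(2)] e(1) by (simp add: field_simps)
    finally show "norm (\<integral>x. norm (D (Suc j) x) \<partial>torus_measure) \<le> (1/2) ^ j"
      by (simp add: e_def)
  qed
  have aeD: "AE x in torus_measure. summable (\<lambda>j. norm (D j x))"
  proof -
    have "(\<integral>\<^sup>+x. (\<Sum>j. ennreal (norm (D j x))) \<partial>torus_measure) =
        (\<Sum>j. \<integral>\<^sup>+x. ennreal (norm (D j x)) \<partial>torus_measure)"
      using Dm by (intro nn_integral_suminf) auto
    also have "\<dots> = (\<Sum>j. ennreal (\<integral>x. norm (D j x) \<partial>torus_measure))"
      using Di by (intro suminf_cong nn_integral_eq_integral) auto
    also have "\<dots> \<noteq> \<infinity>"
      using sD by (simp add: ennreal_suminf_neq_top)
    finally have "AE x in torus_measure. (\<Sum>j. ennreal (norm (D j x))) \<noteq> \<infinity>"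
      using Dm by (intro nn_integral_PInf_AE) auto
    then show ?thesis
      by eventually_elim (rule summable_suminf_not_top, simp_all)
  qed
  define u where "u x = (\<Sum>j. D j x)" for x
  have um: "u \<in> borel_measurable torus_measure"
    unfolding u_def using Dm by (rule borel_measurable_suminf)
  have aeu: "AE x in torus_measure. (\<lambda>J. P J x) \<longlonglongrightarrow> u x"
    using aeD
  proof eventually_elim
    case (elim x)
    then have "(\<lambda>j. D j x) sums u x"
      unfolding u_def by (rule summable_sums[OF summable_norm_cancel])
    then show ?case
      unfolding sums_def PD .
  qed
  \<comment> \<open>Fatou's lemma: the squared norms of the partial sums \<open>P J\<close> never
    exceed the total \<open>suminf q\<close>.\<close>
  have "(\<integral>\<^sup>+x. ennreal ((cmod (u x))\<^sup>2) \<partial>torus_measure)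
      = (\<integral>\<^sup>+x. liminf (\<lambda>J. ennreal ((cmod (P J x))\<^sup>2)) \<partial>torus_measure)"
  proof (rule nn_integral_cong_AE, use aeu in eventually_elim)
    case (elim x)
    then have "(\<lambda>J. ennreal ((cmod (P J x))\<^sup>2)) \<longlonglongrightarrow> ennreal ((cmod (u x))\<^sup>2)"
      by (intro tendsto_ennrealI tendsto_intros)
    then show ?case
      using lim_imp_Liminf trivial_limit_sequentially by metis
  qed
  also have "\<dots> \<le> liminf (\<lambda>J. \<integral>\<^sup>+x. ennreal ((cmod (P J x))\<^sup>2) \<partial>torus_measure)"
    using Pm by (intro nn_integral_liminf) auto
  also have "\<dots> \<le> liminf (\<lambda>J. ennreal (suminf q))"
  proof (intro Liminf_mono always_eventually allI)
    fix J
    have "(\<integral>\<^sup>+x. ennreal ((cmod (P J x))\<^sup>2) \<partial>torus_measure) = ennreal (sum q {..<N J})"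
      unfolding P_def by (subst nn_integral_eq_integral[OF D2i])
        (auto simp: integral_norm_trig_poly sum.reindex[OF inj] q_def)
    also have "\<dots> \<le> ennreal (suminf q)"
      by (intro ennreal_leI sum_le_suminf sq) (auto simp: q0)
    finally show "(\<integral>\<^sup>+x. ennreal ((cmod (P J x))\<^sup>2) \<partial>torus_measure) \<le> ennreal (suminf q)" .
  qed
  also have "\<dots> < \<infinity>"
    by (simp add: Liminf_const)
  finally have "integrable torus_measure (\<lambda>x. (cmod (u x))\<^sup>2)"
    using um by (intro integrableI_nonneg) auto
  \<comment> \<open>This holds at every point, even where the series diverges, because the terms
    themselves are periodic.\<close>
  moreover have "periodic u"
    by (simp add: u_def D_def periodic_def trig_poly_def char_add_lat)
  ultimately have uL: "u \<in> L2_torus"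
    using um by (simp add: L2_torus_def)
  have "torus_inner v u = (\<Sum>\<^sub>\<infinity>k. F_torus v k * cnj (a k))"
    if v: "v \<in> borel_measurable torus_measure" and B: "\<And>x. cmod (v x) \<le> B" for v B
  proof -
    have vi: "integrable torus_measure v"
      by (rule integrable_torus_bounded[OF v B])
    have "integrable torus_measure (\<lambda>x. (cmod (v x))\<^sup>2)"
      using v B by (intro integrable_torus_bounded[where B = "B\<^sup>2"]) (auto intro!: power_mono)
    note FL = Bessel_ell2(1)[OF v this]
    have Dvi: "integrable torus_measure (\<lambda>x. v x * cnj (D j x))" for j
      using integrable_mult_bounded[OF integrable_cnj[OF Di[of j]] v B] by (simp add: mult.commute)
    have "(\<lambda>j. \<integral>x. v x * cnj (D j x) \<partial>torus_measure) sums (\<integral>x. (\<Sum>j. v x * cnj (D j x)) \<partial>torus_measure)"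
    proof (rule sums_integral[OF Dvi])
      show "AE x in torus_measure. summable (\<lambda>j. norm (v x * cnj (D j x)))"
        using aeD by eventually_elim (auto simp: norm_mult intro: summable_mult)
      show "summable (\<lambda>j. \<integral>x. norm (v x * cnj (D j x)) \<partial>torus_measure)"
      proof (rule summable_comparison_test'[OF summable_mult[OF sD, of B]])
        fix j :: nat
        have "(\<integral>x. norm (v x * cnj (D j x)) \<partial>torus_measure) \<le> (\<integral>x. B * norm (D j x) \<partial>torus_measure)"
          using Di[of j] by (intro integral_mono integrable_norm[OF Dvi])
            (auto simp: norm_mult intro!: mult_right_mono B)
        then show "norm (\<integral>x. norm (v x * cnj (D j x)) \<partial>torus_measure) \<le> B * (\<integral>x. norm (D j x) \<partial>torus_measure)"
          by simp
      qed
    qed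
    also have "(\<integral>x. (\<Sum>j. v x * cnj (D j x)) \<partial>torus_measure) = torus_inner v u"
      unfolding torus_inner_def
    proof (rule integral_cong_AE)
      show "(\<lambda>x. \<Sum>j. v x * cnj (D j x)) \<in> borel_measurable torus_measure"
        using Dvi by (intro borel_measurable_suminf borel_measurable_integrable)
      show "(\<lambda>x. v x * cnj (u x)) \<in> borel_measurable torus_measure"
        using v um by (intro borel_measurable_times borel_measurable_cnj)
      show "AE x in torus_measure. (\<Sum>j. v x * cnj (D j x)) = v x * cnj (u x)"
        using aeD
      proof eventually_elim
        case (elim x)
        then have "(\<lambda>j. D j x) sums u x"
          unfolding u_def by (rule summable_sums[OF summable_norm_cancel])
        then have "(\<lambda>j. v x * cnj (D j x)) sums (v x * cnj (u x))"
          by (intro sums_mult) (simp add: sums_cnj)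
        then show ?case
          by (rule sums_unique[symmetric])
      qed
    qed
    finally have "(\<lambda>J. \<Sum>j<J. torus_inner v (D j)) \<longlonglongrightarrow> torus_inner v u"
      unfolding sums_def torus_inner_def .
    moreover have "(\<Sum>j<J. torus_inner v (D j)) = torus_inner v (P J)" for J
    proof -
      have "(\<Sum>j<J. torus_inner v (D j)) = (\<integral>x. (\<Sum>j<J. v x * cnj (D j x)) \<partial>torus_measure)"
        unfolding torus_inner_def using Dvi by (simp add: Bochner_Integration.integral_sum)
      also have "\<dots> = torus_inner v (P J)"
        unfolding torus_inner_def PD[symmetric] by (simp add: sum_distrib_left)
      finally show ?thesis .
    qed
    moreover have "torus_inner v (P J) = (\<Sum>n<N J. F_torus v (?h n) * cnj (a (?h n)))" for J
      unfolding P_def torus_inner_trig_poly[OF vi] by (simp add: sum.reindex[OF inj])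
    \<comment> \<open>The \<open>P J\<close> give the partial sums only along the subsequence
      \<open>N\<close>. The full series converges absolutely by Bessel's inequality, so its value is
      the limit along \<open>N\<close> as well.\<close>
    ultimately have "((\<lambda>m. \<Sum>n<m. F_torus v (?h n) * cnj (a (?h n))) \<circ> N) \<longlonglongrightarrow> torus_inner v u"
      by (simp add: o_def)
    moreover have "(\<lambda>k. cnj (a k)) \<in> ell2"
      using a by (simp add: ell2_def)
    then have "(\<lambda>n. F_torus v (?h n) * cnj (a (?h n))) sums (\<Sum>\<^sub>\<infinity>k. F_torus v k * cnj (a k))"
      by (intro infsum_lattice_sums ell2_mult_summable[OF FL])
    then have "((\<lambda>m. \<Sum>n<m. F_torus v (?h n) * cnj (a (?h n))) \<circ> N) \<longlonglongrightarrow> (\<Sum>\<^sub>\<infinity>k. F_torus v k * cnj (a k))"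
      unfolding sums_def by (rule LIMSEQ_subseq_LIMSEQ[OF _ N])
    ultimately show ?thesis
      using LIMSEQ_unique by blast
  qed
  with uL show ?thesis
    using that by blast
qed

lemma smooth_torus_bounded:
  assumes "v \<in> smooth_torus"
  obtains B where "v \<in> borel_measurable torus_measure" "\<And>x. cmod (v x) \<le> B"
proof -
  have "times_differentiable (Suc 0) v"
    using assms unfolding smooth_torus_def by blast
  then have c: "continuous_on UNIV v"
    by (auto intro!: continuous_at_imp_continuous_on differentiable_imp_continuous_within)
  obtain B where "\<And>x. cmod (v x) \<le> B"
    using bounded_continuous_periodic[OF c] assms unfolding smooth_torus_def by blast
  then show ?thesis
    by (rule that[OF borel_measurable_torus[OF c]])
qed

section \<open>The lattice operator and the adjoint of the toroidal operator\<close>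

context
  fixes \<phi> :: "int ^ 'n \<Rightarrow> real ^ 'n \<Rightarrow> real"
    and \<sigma> :: "int ^ 'n \<Rightarrow> real ^ 'n \<Rightarrow> complex"
    and \<psi> :: "real ^ 'n \<Rightarrow> int ^ 'n \<Rightarrow> real"
    and \<tau> :: "real ^ 'n \<Rightarrow> int ^ 'n \<Rightarrow> complex"
  assumes \<tau>: "\<And>x k. \<tau> x k = cnj (\<sigma> (- k) x)"
    and \<psi>: "\<And>x k. \<psi> x k = - \<phi> (- k) x"
begin

lemma T_torus_char: "T_torus \<psi> \<tau> (char k) x = exp (\<i> * of_real (\<psi> x k)) * \<tau> x k"
proof -
  have "T_torus \<psi> \<tau> (char k) x = (\<Sum>\<^sub>\<infinity>l\<in>{k}. exp (\<i> * of_real (\<psi> x l)) * \<tau> x l * F_torus (char k) l)"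
    unfolding T_torus_def by (rule infsum_cong_neutral) (auto simp: F_torus_char)
  then show ?thesis
    by (simp add: F_torus_char)
qed

lemma T_lattice_eq_inner: "T_lattice \<phi> \<sigma> f k = torus_inner (F_lattice f) (T_torus \<psi> \<tau> (char (- k)))"
  unfolding T_lattice_def torus_inner_def T_torus_char \<tau> \<psi>
  by (simp add: exp_cnj mult_ac)

lemma T_lattice_eq_formal_adjoint:
  "T_lattice \<phi> \<sigma> f = F_lattice_inv_gen (formal_adjoint (T_torus \<psi> \<tau>) (F_lattice f))"
  by (rule ext) (simp add: F_lattice_inv_gen_def formal_adjoint_def T_lattice_eq_inner)

text \<open>The defining identity of the adjoint, tested on the smooth function
  \<open>char (- k)\<close> and conjugated, is the claim at \<open>k\<close>.\<close>

lemma T_lattice_eq_adjoint: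
  assumes "L2_adjoint (T_torus \<psi> \<tau>) (F_lattice f) u"
  shows "T_lattice \<phi> \<sigma> f = F_lattice_inv u"
proof
  fix k
  have "torus_inner (T_torus \<psi> \<tau> (char (- k))) (F_lattice f) = torus_inner (char (- k)) u"
    using assms smooth_char unfolding L2_adjoint_def by blast
  then have "torus_inner (F_lattice f) (T_torus \<psi> \<tau> (char (- k))) = torus_inner u (char (- k))"
    using cnj_torus_inner by metis
  then show "T_lattice \<phi> \<sigma> f k = F_lattice_inv u k"
    by (simp add: T_lattice_eq_inner F_lattice_inv_conv_F_torus F_torus_conv_inner)
qed

text \<open>The values are the Fourier coefficients of \<open>u\<close> at reflected indices, so
  Bessel's inequality applies.\<close>

lemma T_lattice_ell2_if_adjoint:
  assumes "L2_adjoint (T_torus \<psi> \<tau>) (F_lattice f) u"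
  shows "T_lattice \<phi> \<sigma> f \<in> ell2"
proof -
  have "F_torus u \<in> ell2"
    using assms by (intro Bessel_ell2) (auto simp: L2_adjoint_def L2_torus_def)
  then show ?thesis
    using ell2_uminus[of "F_torus u"] T_lattice_eq_adjoint[OF assms]
    by (simp add: F_lattice_inv_conv_F_torus[abs_def] fun_eq_iff ell2_def)
qed

text \<open>The candidate is forced: \<open>F_lattice_inv u\<close> must be
  \<open>T_lattice \<phi> \<sigma> f\<close>, so the Fourier coefficient of \<open>u\<close> at
  \<open>k\<close> must be the value of \<open>T_lattice \<phi> \<sigma> f\<close> at
  \<open>- k\<close>.\<close>

lemma adjoint_if_T_lattice_ell2:
  assumes f: "f \<in> schwartz_lattice" and T: "T_torus_into_L2 \<psi> \<tau>"
    and ell2: "T_lattice \<phi> \<sigma> f \<in> ell2"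
  shows "\<exists>u. L2_adjoint (T_torus \<psi> \<tau>) (F_lattice f) u"
proof -
  define W where "W = (\<Sum>\<^sub>\<infinity>k. cmod (f k))"
  define w where "w = F_lattice f"
  have wm: "w \<in> borel_measurable torus_measure" and wW: "cmod (w x) \<le> W" for x
    unfolding w_def W_def by (rule borel_measurable_F_lattice[OF f], rule norm_F_lattice_le[OF f])
  define t where "t k x = exp (\<i> * of_real (\<psi> x k)) * \<tau> x k" for k x
  have Tt: "T_torus \<psi> \<tau> v x = (\<Sum>\<^sub>\<infinity>k. t k x * F_torus v k)" for v x
    by (simp add: T_torus_def t_def)
  have nt: "cmod (t k x) = cmod (\<tau> x k)" for k x
    by (simp add: t_def norm_mult)
  \<comment> \<open>Each \<open>t k\<close> is the image of the smooth function
    \<open>char k\<close>; in this way \<open>T_torus_into_L2\<close> gives its measurability and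
    integrability.\<close>
  have ti: "integrable torus_measure (t k)" for k
  proof -
    have "t k = T_torus \<psi> \<tau> (char k)"
      by (rule ext) (simp add: t_def T_torus_char)
    then have "t k \<in> L2_torus"
      using T smooth_char unfolding T_torus_into_L2_def by metis
    then show ?thesis
      by (intro integrable_of_square) (auto simp: L2_torus_def)
  qed
  have twi: "integrable torus_measure (\<lambda>x. t k x * cnj (w x))" for k
    by (rule integrable_mult_bounded[OF ti, of _ W]) (use wm wW in \<open>auto intro: borel_measurable_cnj\<close>)
  have "(\<lambda>k. T_lattice \<phi> \<sigma> f (- k)) \<in> ell2"
    using ell2 by (rule ell2_uminus)
  then obtain u where u: "u \<in> L2_torus" and u_inner:
    "\<And>v B. v \<in> borel_measurable torus_measure \<Longrightarrow> (\<And>x. cmod (v x) \<le> B) \<Longrightarrow>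
      torus_inner v u = (\<Sum>\<^sub>\<infinity>k. F_torus v k * cnj (T_lattice \<phi> \<sigma> f (- k)))"
    by (rule Riesz_Fischer) blast
  have "torus_inner (T_torus \<psi> \<tau> v) w = torus_inner v u" if v: "v \<in> smooth_torus" for v
  proof -
    obtain B where vm: "v \<in> borel_measurable torus_measure" and B: "\<And>x. cmod (v x) \<le> B"
      using smooth_torus_bounded[OF v] by blast
    define G where "G x = (\<Sum>\<^sub>\<infinity>k. cmod (\<tau> x k * F_torus v k))" for x
    have TL: "T_torus \<psi> \<tau> v \<in> L2_torus"
      and ae: "AE x in torus_measure. (\<lambda>k. cmod (\<tau> x k * F_torus v k)) summable_on UNIV"
      and GL: "(\<lambda>x. of_real (G x)) \<in> L2_torus"
      using T v unfolding T_torus_into_L2_def G_def by blast+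
    have "integrable torus_measure (\<lambda>x. complex_of_real (G x))"
      using GL by (intro integrable_of_square) (auto simp: L2_torus_def)
    then have Gi: "integrable torus_measure G"
      using integrable_Re by fastforce
    define g where "g k x = t k x * cnj (w x) * F_torus v k" for k x
    have gi: "integrable torus_measure (g k)" for k
      unfolding g_def using twi by simp
    have gn: "cmod (g k x) = cmod (\<tau> x k * F_torus v k) * cmod (w x)" for k x
      by (simp add: g_def norm_mult nt)
    have sum_g: "T_torus \<psi> \<tau> v x * cnj (w x) = (\<Sum>\<^sub>\<infinity>k. g k x)" for x
      unfolding Tt g_def infsum_cmult_left'[symmetric] by (simp add: mult_ac)
    have "torus_inner (T_torus \<psi> \<tau> v) w = (\<integral>x. (\<Sum>\<^sub>\<infinity>k. g k x) \<partial>torus_measure)"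
      unfolding torus_inner_def sum_g ..
    also have "\<dots> = (\<Sum>\<^sub>\<infinity>k. \<integral>x. g k x \<partial>torus_measure)"
    proof (rule integral_infsum_lattice[OF gi])
      show "AE x in torus_measure. (\<lambda>k. cmod (g k x)) summable_on UNIV"
        using ae unfolding gn by eventually_elim (rule summable_on_cmult_left)
      show "(\<lambda>x. \<Sum>\<^sub>\<infinity>k. g k x) \<in> borel_measurable torus_measure"
        unfolding sum_g[symmetric] using TL wm
        by (intro borel_measurable_times borel_measurable_cnj) (simp_all add: L2_torus_def)
      show "(\<lambda>k. \<integral>x. cmod (g k x) \<partial>torus_measure) summable_on UNIV"
      proof (rule nonneg_bdd_above_summable_on, simp, rule bdd_aboveI2)
        fix F :: "(int ^ 'n) set" assume "F \<in> {F. F \<subseteq> UNIV \<and> finite F}"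
        then have F: "finite F" by simp
        have "(\<Sum>k\<in>F. \<integral>x. cmod (g k x) \<partial>torus_measure) = (\<integral>x. (\<Sum>k\<in>F. cmod (g k x)) \<partial>torus_measure)"
          using gi by (simp add: Bochner_Integration.integral_sum)
        \<comment> \<open>\<open>G\<close> lies in L^2, hence in L^1, and \<open>w\<close> is
          bounded by \<open>W\<close>: one integrable majorant serves every finite
          \<open>F\<close>.\<close>
        also have "\<dots> \<le> (\<integral>x. G x * W \<partial>torus_measure)"
        proof (rule integral_mono_AE)
          show "integrable torus_measure (\<lambda>x. \<Sum>k\<in>F. cmod (g k x))"
            using gi by auto
          show "integrable torus_measure (\<lambda>x. G x * W)"
            using Gi by simp
          show "AE x in torus_measure. (\<Sum>k\<in>F. cmod (g k x)) \<le> G x * W"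
            using ae
          proof eventually_elim
            case (elim x)
            have "(\<Sum>k\<in>F. cmod (g k x)) = (\<Sum>k\<in>F. cmod (\<tau> x k * F_torus v k)) * cmod (w x)"
              unfolding gn sum_distrib_right ..
            also have "\<dots> \<le> G x * W"
              unfolding G_def
              by (intro mult_mono finite_sum_le_infsum elim F wW infsum_nonneg) auto
            finally show ?case .
          qed
        qed
        finally show "(\<Sum>k\<in>F. \<integral>x. cmod (g k x) \<partial>torus_measure) \<le> (\<integral>x. G x * W \<partial>torus_measure)" .
      qed
    qed
    also have "\<dots> = (\<Sum>\<^sub>\<infinity>k. F_torus v k * cnj (T_lattice \<phi> \<sigma> f (- k)))"
    proof (rule infsum_cong)
      fix k
      have "cnj (T_lattice \<phi> \<sigma> f (- k)) = torus_inner (T_torus \<psi> \<tau> (char k)) w"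
        unfolding T_lattice_eq_inner cnj_torus_inner w_def by simp
      also have "\<dots> = (\<integral>x. t k x * cnj (w x) \<partial>torus_measure)"
        by (simp add: torus_inner_def T_torus_char t_def)
      finally show "(\<integral>x. g k x \<partial>torus_measure) = F_torus v k * cnj (T_lattice \<phi> \<sigma> f (- k))"
        unfolding g_def by (simp add: mult.commute)
    qed
    also have "\<dots> = torus_inner v u"
      using u_inner[OF vm B] by simp
    finally show ?thesis .
  qed
  then have "L2_adjoint (T_torus \<psi> \<tau>) (F_lattice f) u"
    using u F_lattice_L2[OF f] by (simp add: L2_adjoint_def w_def)
  then show ?thesis by blast
qed

end

section \<open>Functions with bounded derivatives\<close>

lemma periodic_pderiv_dir:
  assumes "periodic f"
  shows "periodic (pderiv_dir i f)"
proof -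
  have "f (x + lat m + t *\<^sub>R axis i 1) = f (x + t *\<^sub>R axis i 1)" for x m and t :: real
    using assms unfolding periodic_def by (metis add.assoc add.commute)
  then show ?thesis
    by (simp add: periodic_def pderiv_dir_def)
qed

lemma pderiv_dir_add:
  assumes "f differentiable (at x)" "g differentiable (at x)"
  shows "pderiv_dir i (\<lambda>x. f x + g x) x = pderiv_dir i f x + pderiv_dir i g x"
  using assms unfolding differentiable_def
  by (auto simp: pderiv_dir_eq pderiv_dir_eq[OF has_derivative_add])

lemma pderiv_dir_bounded_linear:
  assumes "bounded_linear T" "f differentiable (at x)"
  shows "pderiv_dir i (\<lambda>x. T (f x)) x = T (pderiv_dir i f x)"
  using assms(2) unfolding differentiable_def
  by (auto simp: pderiv_dir_eq pderiv_dir_eq[OF bounded_linear.has_derivative[OF assms(1)]])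

lemma pderiv_dir_mult:
  fixes f g :: "real ^ 'n \<Rightarrow> 'a::real_normed_algebra"
  assumes "f differentiable (at x)" "g differentiable (at x)"
  shows "pderiv_dir i (\<lambda>x. f x * g x) x = f x * pderiv_dir i g x + pderiv_dir i f x * g x"
  using assms unfolding differentiable_def
  by (auto simp: pderiv_dir_eq pderiv_dir_eq[OF has_derivative_mult])

lemma pderiv_dir_inverse:
  fixes f :: "real ^ 'n \<Rightarrow> 'a::real_normed_field"
  assumes "f differentiable (at x)" "f x \<noteq> 0"
  shows "pderiv_dir i (\<lambda>x. inverse (f x)) x = - (inverse (f x) * pderiv_dir i f x * inverse (f x))"
proof -
  obtain f' where "(f has_derivative f') (at x)"
    using assms unfolding differentiable_def by blast
  then show ?thesis
    using pderiv_dir_eq[OF Deriv.has_derivative_inverse[of f x f' UNIV, OF assms(2)], of i]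
    by (simp add: pderiv_dir_eq)
qed

text \<open>Derivatives of order below \<open>m\<close> are differentiable; those of order
  \<open>m\<close> are merely bounded. A single \<open>B\<close> for all orders lets each calculus
  rule return a constant that depends on the functions only through their bounds, hence is uniform
  in families.\<close>

primrec derivs_bounded :: "nat \<Rightarrow> real \<Rightarrow> (real ^ 'n \<Rightarrow> 'a::real_normed_vector) \<Rightarrow> bool" where
  "derivs_bounded 0 B f \<longleftrightarrow> (\<forall>x. norm (f x) \<le> B)"
| "derivs_bounded (Suc m) B f \<longleftrightarrow> (\<forall>x. norm (f x) \<le> B) \<and> (\<forall>x. f differentiable (at x)) \<and>
     (\<forall>i. derivs_bounded m B (pderiv_dir i f))"

lemma derivs_bounded_norm_le: "derivs_bounded m B f \<Longrightarrow> norm (f x) \<le> B"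
  by (cases m) auto

lemma derivs_bounded_nonneg: "derivs_bounded m B f \<Longrightarrow> 0 \<le> B"
  using derivs_bounded_norm_le norm_ge_zero order_trans by metis

lemma derivs_bounded_mono: "derivs_bounded m B f \<Longrightarrow> B \<le> B' \<Longrightarrow> derivs_bounded m B' f"
  by (induction m arbitrary: f) (auto intro: order_trans)

lemma derivs_bounded_SucD: "derivs_bounded (Suc m) B f \<Longrightarrow> derivs_bounded m B f"
  by (induction m arbitrary: f) auto

lemma derivs_bounded_zero: "derivs_bounded m 0 (\<lambda>x :: real ^ 'n. 0 :: 'a::real_normed_vector)"
proof (induction m)
  case (Suc m)
  have "pderiv_dir i (\<lambda>x :: real ^ 'n. 0 :: 'a) = (\<lambda>x. 0)" for i
    by (simp add: pderiv_dir_def fun_eq_iff vector_derivative_const_at)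
  then show ?case
    using Suc by simp
qed simp

lemma derivs_bounded_add:
  "derivs_bounded m B f \<Longrightarrow> derivs_bounded m B' g \<Longrightarrow> derivs_bounded m (B + B') (\<lambda>x. f x + g x)"
proof (induction m arbitrary: f g)
  case 0
  then show ?case
    by (auto intro!: norm_triangle_mono)
next
  case (Suc m)
  then have "pderiv_dir i (\<lambda>x. f x + g x) = (\<lambda>x. pderiv_dir i f x + pderiv_dir i g x)" for i
    by (simp add: fun_eq_iff pderiv_dir_add)
  then show ?case
    using Suc by (auto intro!: norm_triangle_mono)
qed

lemma derivs_bounded_sum:
  assumes "\<And>j. j \<in> J \<Longrightarrow> derivs_bounded m B (f j)"
  shows "derivs_bounded m (real (card J) * B) (\<lambda>x. \<Sum>j\<in>J. f j x)"
proof (cases "finite J")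
  case True
  then show ?thesis
    using assms
  proof (induction J)
    case (insert j J)
    then have "derivs_bounded m (B + real (card J) * B) (\<lambda>x. f j x + (\<Sum>j\<in>J. f j x))"
      by (intro derivs_bounded_add) auto
    then show ?case
      using insert by (simp add: algebra_simps)
  qed (simp add: derivs_bounded_zero)
qed (simp add: derivs_bounded_zero)

text \<open>Covers negation, conjugation, the embedding of the reals and division by a constant at
  once.\<close>

lemma derivs_bounded_linear:
  assumes T: "bounded_linear T" "\<And>y. norm (T y) \<le> K * norm y" and K: "0 \<le> K"
  shows "derivs_bounded m B f \<Longrightarrow> derivs_bounded m (K * B) (\<lambda>x. T (f x))"
proof (induction m arbitrary: f)
  case 0
  then show ?case
    using order_trans[OF T(2) mult_left_mono[OF _ K]] by simp
next
  case (Suc m)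
  have "norm (T (f x)) \<le> K * B" for x
    using order_trans[OF T(2) mult_left_mono[OF derivs_bounded_norm_le[OF Suc.prems] K]] .
  moreover have "pderiv_dir i (\<lambda>x. T (f x)) = (\<lambda>x. T (pderiv_dir i f x))" for i
    using Suc.prems by (simp add: fun_eq_iff pderiv_dir_bounded_linear[OF T(1)])
  moreover have "(\<lambda>x. T (f x)) differentiable (at x)" for x
  proof -
    have "f differentiable (at x)"
      using Suc.prems by simp
    then show ?thesis
      using bounded_linear.has_derivative[OF T(1)] unfolding differentiable_def by blast
  qed
  ultimately show ?case
    using Suc by simp
qed

text \<open>By Leibniz' rule each differentiation at most doubles the number of terms, whence the
  factor 2^m.\<close>

lemma derivs_bounded_mult:
  fixes f g :: "real ^ 'n \<Rightarrow> 'a::real_normed_algebra"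
  shows "derivs_bounded m B f \<Longrightarrow> derivs_bounded m B' g \<Longrightarrow>
    derivs_bounded m (2 ^ m * (B * B')) (\<lambda>x. f x * g x)"
proof (induction m arbitrary: f g)
  case 0
  then show ?case
    by (auto intro!: order_trans[OF norm_mult_ineq] mult_mono intro: order_trans[OF norm_ge_zero])
next
  case (Suc m)
  note f = derivs_bounded_SucD[OF Suc.prems(1)] and g = derivs_bounded_SucD[OF Suc.prems(2)]
  have BB': "0 \<le> B * B'"
    using f[THEN derivs_bounded_nonneg] g[THEN derivs_bounded_nonneg] by simp
  have "norm (f x * g x) \<le> B * B'" for x
    using derivs_bounded_norm_le[OF f] derivs_bounded_norm_le[OF g] derivs_bounded_nonneg[OF f]
    by (intro order_trans[OF norm_mult_ineq] mult_mono) auto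
  also have "B * B' \<le> 2 ^ Suc m * (B * B')"
    using mult_right_mono[OF one_le_power[of "2 :: real" "Suc m"] BB'] by simp
  finally have "norm (f x * g x) \<le> 2 ^ Suc m * (B * B')" for x .
  moreover have "pderiv_dir i (\<lambda>x. f x * g x) = (\<lambda>x. f x * pderiv_dir i g x + pderiv_dir i f x * g x)" for i
    using Suc.prems by (simp add: fun_eq_iff pderiv_dir_mult)
  moreover have "derivs_bounded m (2 ^ m * (B * B') + 2 ^ m * (B * B'))
      (\<lambda>x. f x * pderiv_dir i g x + pderiv_dir i f x * g x)" for i
    using Suc.prems f g by (intro derivs_bounded_add Suc.IH) auto
  moreover have "2 ^ m * (B * B') + 2 ^ m * (B * B') = 2 ^ Suc m * (B * B')"
    by simp
  ultimately show ?case
    using Suc.prems by (simp only: derivs_bounded.simps differentiable_mult) blast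
qed

text \<open>The derivative of 1/f is the product of -1/f, f' and 1/f, to which the rule for products
  and the induction hypothesis apply. \<open>B'\<close> is quantified before \<open>f\<close>: it
  depends only on \<open>m\<close>, \<open>B\<close> and \<open>c\<close>.\<close>

lemma derivs_bounded_inverse:
  fixes c B :: real
  assumes "c > 0"
  shows "\<exists>B'. \<forall>f :: real ^ 'n \<Rightarrow> 'a::real_normed_field. derivs_bounded m B f \<and> (\<forall>x. c \<le> norm (f x)) \<longrightarrow>
    derivs_bounded m B' (\<lambda>x. inverse (f x))"
proof (induction m)
  have inv: "norm (inverse y) \<le> 1 / c" if "c \<le> norm y" for y :: 'a
    using le_imp_inverse_le[OF that assms] nonzero_norm_inverse[of y] that assms
    by (cases "y = 0") (auto simp: inverse_eq_divide norm_divide)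
  case 0
  then show ?case
    using inv by (intro exI[of _ "1 / c"]) auto
next
  have inv: "norm (inverse y) \<le> 1 / c" if "c \<le> norm y" for y :: 'a
    using le_imp_inverse_le[OF that assms] nonzero_norm_inverse[of y] that assms
    by (cases "y = 0") (auto simp: inverse_eq_divide norm_divide)
  case (Suc m)
  then obtain B1 where B1: "\<And>f :: real ^ 'n \<Rightarrow> 'a. derivs_bounded m B f \<Longrightarrow> (\<And>x. c \<le> norm (f x)) \<Longrightarrow>
      derivs_bounded m B1 (\<lambda>x. inverse (f x))"
    by blast
  define B2 where "B2 = 2 ^ m * (2 ^ m * (B1 * B) * B1)"
  show ?case
  proof (intro exI[of _ "max (1 / c) B2"] allI impI, elim conjE)
    fix f :: "real ^ 'n \<Rightarrow> 'a"
    assume f: "derivs_bounded (Suc m) B f" and c: "\<forall>x. c \<le> norm (f x)"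
    have nz: "f x \<noteq> 0" for x
      using c assms by (metis norm_zero not_le)
    have df: "f differentiable (at x)" for x
      using f by simp
    note i = B1[OF derivs_bounded_SucD[OF f] c[rule_format]]
    have "derivs_bounded m B (pderiv_dir j f)" for j
      using f by simp
    then have "derivs_bounded m B2 (\<lambda>x. inverse (f x) * pderiv_dir j f x * inverse (f x))" for j
      unfolding B2_def by (intro derivs_bounded_mult i)
    then have "derivs_bounded m (1 * B2) (\<lambda>x. - (inverse (f x) * pderiv_dir j f x * inverse (f x)))" for j
      by (intro derivs_bounded_linear bounded_linear_minus bounded_linear_ident) auto
    moreover have "pderiv_dir j (\<lambda>x. inverse (f x)) = (\<lambda>x. - (inverse (f x) * pderiv_dir j f x * inverse (f x)))" for j
      using df nz by (simp add: fun_eq_iff pderiv_dir_inverse)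
    ultimately have "derivs_bounded m B2 (pderiv_dir j (\<lambda>x. inverse (f x)))" for j
      by simp
    then have "derivs_bounded m (max (1 / c) B2) (pderiv_dir j (\<lambda>x. inverse (f x)))" for j
      by (rule derivs_bounded_mono) simp
    moreover have "norm (inverse (f x)) \<le> max (1 / c) B2" for x
      using inv[of "f x"] c by (auto simp: max_def intro: order_trans)
    ultimately show "derivs_bounded (Suc m) (max (1 / c) B2) (\<lambda>x. inverse (f x))"
      using df nz by (auto intro!: differentiable_inverse)
  qed
qed

section \<open>From bounds on the cube to uniform derivative bounds\<close>

lemma pderivs_append: "pderivs (\<alpha> @ \<beta>) f = pderivs \<alpha> (pderivs \<beta> f)"
  by (induction \<alpha>) auto

lemma periodic_bound_from_cube:
  assumes "periodic f" "\<And>x. x \<in> unit_cube \<Longrightarrow> norm (f x) \<le> B"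
  shows "norm (f x) \<le> B"
proof -
  obtain m where "x + lat m \<in> unit_cube"
    using ex_add_lat_in_cube by blast
  then have "norm (f (x + lat m)) \<le> B"
    by (rule assms(2))
  then show ?thesis
    using assms(1) by (simp add: periodic_def)
qed

lemma derivs_boundedI:
  assumes "periodic f" "times_differentiable m f"
    and "\<And>\<alpha> x. length \<alpha> \<le> m \<Longrightarrow> x \<in> unit_cube \<Longrightarrow> norm (pderivs \<alpha> f x) \<le> B"
  shows "derivs_bounded m B f"
  using assms
proof (induction m arbitrary: f)
  case 0
  then show ?case
    using periodic_bound_from_cube[OF 0(1), of B] 0(3)[of "[]"] by simp
next
  case (Suc m)
  have "derivs_bounded m B (pderiv_dir i f)" for i
  proof (rule Suc.IH)
    \<comment> \<open>\<open>pderivs\<close> differentiates in the direction of the last list entry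
      before all others, so \<open>i\<close> is appended at the end.\<close>
    show "norm (pderivs \<alpha> (pderiv_dir i f) x) \<le> B" if "length \<alpha> \<le> m" "x \<in> unit_cube" for \<alpha> x
      using Suc.prems(3)[of "\<alpha> @ [i]"] that by (simp add: pderivs_append)
    show "periodic (pderiv_dir i f)"
      using Suc.prems(1) by (rule periodic_pderiv_dir)
    show "times_differentiable m (pderiv_dir i f)"
      using Suc.prems(2) by simp
  qed
  then show ?case
    using Suc.prems(2) periodic_bound_from_cube[OF Suc.prems(1), of B] Suc.prems(3)[of "[]"] by simp
qed

text \<open>Walk from \<open>k\<close> to \<open>l\<close> in unit steps along the axes. The
  increments telescope, each costs \<open>C\<close>, and the number of steps is the l^1 distance, on
  which the induction runs.\<close>

lemma derivs_bounded_lattice_diff: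
  fixes u :: "int ^ 'n \<Rightarrow> real ^ 'n \<Rightarrow> 'a::real_normed_vector"
  assumes step: "\<And>k j. derivs_bounded m C (\<lambda>x. u (k + axis j 1) x - u k x)"
  shows "derivs_bounded m (C * real (\<Sum>i\<in>UNIV. nat \<bar>k $ i - l $ i\<bar>)) (\<lambda>x. u k x - u l x)"
proof (induction "\<Sum>i\<in>UNIV. nat \<bar>k $ i - l $ i\<bar>" arbitrary: k)
  case 0
  then have "k = l"
    by (simp add: vec_eq_iff)
  then show ?case
    by (simp add: derivs_bounded_zero)
next
  case (Suc N)
  have "\<exists>i. k $ i \<noteq> l $ i"
  proof (rule ccontr)
    assume "\<nexists>i. k $ i \<noteq> l $ i"
    then show False
      using Suc(2) by simp
  qed
  then obtain i where i: "k $ i \<noteq> l $ i" by blast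
  have norm1: "(\<Sum>j\<in>UNIV. nat \<bar>k $ j - l $ j\<bar>) =
      nat \<bar>k $ i - l $ i\<bar> + (\<Sum>j\<in>UNIV - {i}. nat \<bar>k $ j - l $ j\<bar>)" for k :: "int ^ 'n"
    by (rule sum.remove) auto
  have rest: "(\<Sum>j\<in>UNIV - {i}. nat \<bar>(k + axis i s) $ j - l $ j\<bar>) = (\<Sum>j\<in>UNIV - {i}. nat \<bar>k $ j - l $ j\<bar>)" for s
    by (rule sum.cong) (auto simp: axis_def)
  have N: "Suc N = (\<Sum>j\<in>UNIV. nat \<bar>k $ j - l $ j\<bar>)"
    by (rule Suc(2))
  \<comment> \<open>Here \<open>s\<close> is 1 or -1, whichever brings coordinate \<open>i\<close>
    one step nearer to that of \<open>l\<close>.\<close>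
  have *: "derivs_bounded m (C * real (Suc N)) (\<lambda>x. u k x - u l x)"
    if s: "derivs_bounded m C (\<lambda>x. u k x - u (k + axis i s) x)"
      and a: "nat \<bar>k $ i - l $ i\<bar> = Suc (nat \<bar>k $ i + s - l $ i\<bar>)" for s
  proof -
    have "N = (\<Sum>j\<in>UNIV. nat \<bar>(k + axis i s) $ j - l $ j\<bar>)"
      using N a unfolding norm1 rest by (simp add: axis_def)
    note N' = this
    from derivs_bounded_add[OF s Suc(1)[OF N']]
    show ?thesis
      unfolding N'[symmetric] by (simp add: algebra_simps)
  qed
  show ?case
  proof (cases "k $ i > l $ i")
    case True
    \<comment> \<open>A backward step from \<open>k\<close> is the reverse of the forward step that
      starts at \<open>k + axis i (- 1)\<close>, and \<open>step\<close> speaks of forward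
      steps.\<close>
    have eq: "(k + axis i (- 1)) + axis i 1 = k"
      by (simp add: vec_eq_iff axis_def)
    have "derivs_bounded m C (\<lambda>x. u k x - u (k + axis i (- 1)) x)"
      using step[of "k + axis i (- 1)" i] unfolding eq .
    moreover have "nat \<bar>k $ i - l $ i\<bar> = Suc (nat \<bar>k $ i + - 1 - l $ i\<bar>)"
      using True by simp
    ultimately show ?thesis
      unfolding N[symmetric] by (rule *)
  next
    case False
    have "derivs_bounded m (1 * C) (\<lambda>x. - (u (k + axis i 1) x - u k x))"
      by (intro derivs_bounded_linear bounded_linear_minus bounded_linear_ident step) auto
    then have "derivs_bounded m C (\<lambda>x. u k x - u (k + axis i 1) x)"
      by simp
    moreover have "nat \<bar>k $ i - l $ i\<bar> = Suc (nat \<bar>k $ i + 1 - l $ i\<bar>)"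
      using False i by simp
    ultimately show ?thesis
      unfolding N[symmetric] by (rule *)
  qed
qed

text \<open>The difference quotients have integral \<open>0\<close> by translation invariance, and they are dominated
  by the bound on the derivative. So the derivative need not be continuous.\<close>

lemma integral_pderiv_dir_eq_0:
  fixes g :: "real ^ 'n \<Rightarrow> complex"
  assumes g: "periodic g" "\<And>x. g differentiable (at x)" and B: "\<And>x. cmod (pderiv_dir i g x) \<le> B"
  shows "integrable torus_measure (pderiv_dir i g)" "integral\<^sup>L torus_measure (pderiv_dir i g) = 0"
proof -
  \<comment> \<open>The offset 2 keeps \<open>h n\<close> strictly below 1 from n = 0 on, as the
    shift of the cube requires.\<close>
  define h :: "nat \<Rightarrow> real" where "h n = 1 / real (n + 2)" for n
  have h: "0 < h n" "h n < 1" for n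
    by (auto simp: h_def)
  define q where "q n x = (g (x + h n *\<^sub>R axis i 1) - g x) / of_real (h n)" for n x
  have der: "((\<lambda>t. g (x + t *\<^sub>R axis i 1)) has_vector_derivative pderiv_dir i g (x + s *\<^sub>R axis i 1)) (at s)" for x s
    using g(2)[of "x + s *\<^sub>R axis i 1"] pderiv_dir_has_vector_derivative[of g _ x s i] pderiv_dir_eq
    unfolding differentiable_def by metis
  have c: "continuous_on UNIV g"
    using g(2) by (auto intro!: continuous_at_imp_continuous_on differentiable_imp_continuous_within)
  have cs: "continuous_on UNIV (\<lambda>x. g (x + t *\<^sub>R axis i 1))" for t
    by (intro continuous_on_compose2[OF c] continuous_intros) auto
  have qm: "q n \<in> borel_measurable torus_measure" for n
    unfolding q_def using h(1)[of n] by (intro borel_measurable_torus continuous_intros c cs) auto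
  have lim: "(\<lambda>n. q n x) \<longlonglongrightarrow> pderiv_dir i g x" for x
  proof -
    let ?d = "pderiv_dir i g x"
    have "((\<lambda>t. norm (g (x + t *\<^sub>R axis i 1) - g x - t *\<^sub>R ?d) / norm t) \<longlongrightarrow> 0) (at 0)"
      using der[of x 0] by (simp add: has_vector_derivative_def has_derivative_at)
    moreover have "filterlim h (at 0) sequentially"
      using LIMSEQ_ignore_initial_segment[OF lim_1_over_n[where ?'a = real], of 2] h(1)
      by (auto simp: filterlim_at h_def[abs_def] add.commute)
    ultimately have "(\<lambda>n. norm (g (x + h n *\<^sub>R axis i 1) - g x - h n *\<^sub>R ?d) / norm (h n)) \<longlonglongrightarrow> 0"
      by (rule filterlim_compose)
    moreover have "norm (g (x + h n *\<^sub>R axis i 1) - g x - h n *\<^sub>R ?d) / norm (h n) = norm (q n x - ?d)" for n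
    proof -
      have "q n x - ?d = (g (x + h n *\<^sub>R axis i 1) - g x - h n *\<^sub>R ?d) / of_real (h n)"
        using h(1)[of n] by (simp add: q_def diff_divide_distrib scaleR_conv_of_real)
      then show ?thesis
        by (simp add: norm_divide)
    qed
    ultimately have "(\<lambda>n. q n x - ?d) \<longlonglongrightarrow> 0"
      by (simp add: tendsto_norm_zero_iff)
    then show ?thesis
      by (rule LIM_zero_cancel)
  qed
  have bd: "cmod (q n x) \<le> B" for n x
  proof -
    \<comment> \<open>Mean value inequality on the segment from 0 to \<open>h n\<close>, with
      comparison function t \<mapsto> B t; the vanishing summands spell out its value at the left
      end.\<close>
    have "norm (g (x + h n *\<^sub>R axis i 1) - g (x + 0 *\<^sub>R axis i 1)) \<le> B * h n - B * 0"
      by (rule differentiable_bound_general[OF h(1)[of n], where f' = "\<lambda>s. pderiv_dir i g (x + s *\<^sub>R axis i 1)" and \<phi>' = "\<lambda>_. B"])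
         (auto intro!: continuous_intros derivative_eq_intros der B continuous_on_compose2[OF c])
    then show ?thesis
      using h(1)[of n] by (simp add: q_def norm_divide field_simps)
  qed
  have q0: "integral\<^sup>L torus_measure (q n) = 0" for n
  proof -
    have "integrable torus_measure (\<lambda>x. g (x + h n *\<^sub>R axis i 1))" "integrable torus_measure g"
      unfolding torus_measure_def unit_cube_def
      by (auto intro!: continuous_imp_integrable continuous_on_subset[OF c] continuous_on_subset[OF cs])
    then show ?thesis
      unfolding q_def by (simp add: integral_torus_shift[OF c g(1) h])
  qed
  have m: "pderiv_dir i g \<in> borel_measurable torus_measure"
    by (rule borel_measurable_LIMSEQ_metric[OF qm lim])
  show "integrable torus_measure (pderiv_dir i g)"
    by (rule integrable_torus_bounded[OF m B])
  have "(\<lambda>n. integral\<^sup>L torus_measure (q n)) \<longlonglongrightarrow> integral\<^sup>L torus_measure (pderiv_dir i g)"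
    by (rule integral_dominated_convergence[where w = "\<lambda>_. B"])
       (use m qm lim bd finite_measure.integrable_const[OF finite_measure_torus] in auto)
  then show "integral\<^sup>L torus_measure (pderiv_dir i g) = 0"
    unfolding q0 by (simp add: LIMSEQ_const_iff)
qed

section \<open>Nonstationary phase and almost orthogonality\<close>

text \<open>The field \<open>w\<close> is dual to \<open>g\<close>: since the
  \<open>g i x * w i x\<close> sum to 1, the divergence of the field with components
  \<open>E * a * w i\<close> is \<open>\<i> * \<mu> * E * a + E * b\<close>, and a divergence has
  integral 0. In the bound on \<open>b\<close>, n counts the directions and the power of 2 comes
  from the product rule.\<close>

lemma integral_by_parts_phase:
  fixes E :: "real ^ 'n \<Rightarrow> complex"
  assumes E: "periodic E" "\<And>x. E differentiable (at x)" "\<And>x. cmod (E x) \<le> 1"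
    and dE: "\<And>i x. pderiv_dir i E x = \<i> * of_real \<mu> * g i x * E x"
    and g: "\<And>i x. cmod (g i x) \<le> G"
    and a: "periodic a" "derivs_bounded (Suc r) A a"
    and w: "\<And>i. periodic (w i)" "\<And>i. derivs_bounded (Suc r) W (w i)"
    and gw: "\<And>x. (\<Sum>i\<in>UNIV. g i x * w i x) = 1"
    and \<mu>: "\<mu> > 0"
    and b_def: "b = (\<lambda>x. \<Sum>i\<in>UNIV. pderiv_dir i (\<lambda>x. a x * w i x) x)"
  shows "(\<integral>x. E x * a x \<partial>torus_measure) = (\<i> / of_real \<mu>) * (\<integral>x. E x * b x \<partial>torus_measure)"
    and "periodic b"
    and "derivs_bounded r (real CARD('n) * (2 ^ Suc r * (A * W))) b"
proof -
  have aw: "derivs_bounded (Suc r) (2 ^ Suc r * (A * W)) (\<lambda>x. a x * w i x)" for i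
    by (intro derivs_bounded_mult a w)
  have paw: "periodic (\<lambda>x. a x * w i x)" for i
    using a w by (simp add: periodic_def)
  show "periodic b"
    using periodic_pderiv_dir[OF paw] by (simp add: b_def periodic_def)
  show "derivs_bounded r (real CARD('n) * (2 ^ Suc r * (A * W))) b"
    unfolding b_def using aw by (intro derivs_bounded_sum) simp
  define h where "h i x = E x * (a x * w i x)" for i x
  have hd: "h i differentiable (at x)" for i x
    unfolding h_def[abs_def] using E(2) aw[of i] by (subst differentiable_mult) auto
  have dh: "pderiv_dir i (h i) x = \<i> * of_real \<mu> * (g i x * w i x) * (E x * a x) +
      E x * pderiv_dir i (\<lambda>x. a x * w i x) x" for i x
    unfolding h_def[abs_def] using E(2) aw[of i] by (subst pderiv_dir_mult) (auto simp: dE mult_ac)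
  \<comment> \<open>A crude bound that grows with \<mu>, used only to make the integral of the
    derivative vanish; it does not enter the estimate.\<close>
  have "cmod (pderiv_dir i (h i) x) \<le> \<mu> * G * A * W + 2 ^ Suc r * (A * W)" for i x
  proof -
    have "cmod (\<i> * of_real \<mu> * (g i x * w i x) * (E x * a x)) = \<mu> * (cmod (g i x) * cmod (w i x)) * (cmod (E x) * cmod (a x))"
      using \<mu> by (simp add: norm_mult)
    also have "\<dots> \<le> \<mu> * (G * W) * (1 * A)"
      using \<mu> g[of i x] derivs_bounded_norm_le[OF w(2)[of i], of x] derivs_bounded_norm_le[OF a(2), of x]
        derivs_bounded_nonneg[OF a(2)] derivs_bounded_nonneg[OF w(2)] order_trans[OF norm_ge_zero g]
      by (intro mult_mono E(3)) auto
    finally have 1: "cmod (\<i> * of_real \<mu> * (g i x * w i x) * (E x * a x)) \<le> \<mu> * G * A * W"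
      by (simp add: mult_ac)
    have "cmod (E x * pderiv_dir i (\<lambda>x. a x * w i x) x) \<le> 1 * (2 ^ Suc r * (A * W))"
      unfolding norm_mult using aw[of i]
      by (intro mult_mono E(3)) (auto intro: derivs_bounded_norm_le)
    then show ?thesis
      unfolding dh using 1 by (intro norm_triangle_mono) auto
  qed
  note zero = integral_pderiv_dir_eq_0[OF _ hd this]
  have ph: "periodic (h i)" for i
    using E(1) a(1) w(1) by (simp add: h_def periodic_def)
  have c: "continuous_on UNIV E" "continuous_on UNIV a"
    using E(2) a(2) by (auto intro!: continuous_at_imp_continuous_on differentiable_imp_continuous_within)
  have iEa: "integrable torus_measure (\<lambda>x. E x * a x)"
    using borel_measurable_torus[OF continuous_on_mult[OF c]]
  proof (rule integrable_torus_bounded)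
    show "cmod (E x * a x) \<le> 1 * A" for x
      unfolding norm_mult using derivs_bounded_norm_le[OF a(2)] by (intro mult_mono E(3)) auto
  qed
  have sum: "(\<Sum>i\<in>UNIV. pderiv_dir i (h i) x) = \<i> * of_real \<mu> * (E x * a x) + E x * b x" for x
    unfolding dh sum.distrib b_def
    by (simp add: sum_distrib_left[symmetric] sum_distrib_right[symmetric] gw)
  \<comment> \<open>For \<open>r = 0\<close> the function \<open>b\<close> is only known to be
    bounded, so integrability of \<open>E * b\<close> is read off from the divergence, whose other
    terms are integrable.\<close>
  have "integrable torus_measure (\<lambda>x. \<Sum>i\<in>UNIV. pderiv_dir i (h i) x)"
    using zero(1)[OF ph] by auto
  then have "integrable torus_measure (\<lambda>x. (\<i> * of_real \<mu> * (E x * a x) + E x * b x) - \<i> * of_real \<mu> * (E x * a x))"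
    unfolding sum using iEa by (intro Bochner_Integration.integrable_diff) auto
  then have iEb: "integrable torus_measure (\<lambda>x. E x * b x)"
    by simp
  have "0 = (\<integral>x. (\<Sum>i\<in>UNIV. pderiv_dir i (h i) x) \<partial>torus_measure)"
    using zero[OF ph] by (simp add: Bochner_Integration.integral_sum)
  also have "\<dots> = \<i> * of_real \<mu> * (\<integral>x. E x * a x \<partial>torus_measure) + (\<integral>x. E x * b x \<partial>torus_measure)"
    unfolding sum using iEa iEb by simp
  finally have "(\<integral>x. E x * b x \<partial>torus_measure) = - (\<i> * of_real \<mu> * (\<integral>x. E x * a x \<partial>torus_measure))"
    by (metis add.commute eq_neg_iff_add_eq_0)
  then show "(\<integral>x. E x * a x \<partial>torus_measure) = (\<i> / of_real \<mu>) * (\<integral>x. E x * b x \<partial>torus_measure)"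
    using \<mu> by simp
qed

text \<open>Each integration by parts gains a factor 1 / \<mu> and costs the amplitude one
  derivative. In the product, \<open>s\<close> is the number of derivatives left after the step in
  question.\<close>

lemma nonstationary_phase:
  fixes E :: "real ^ 'n \<Rightarrow> complex"
  assumes E: "periodic E" "\<And>x. E differentiable (at x)" "\<And>x. cmod (E x) \<le> 1"
    and dE: "\<And>i x. pderiv_dir i E x = \<i> * of_real \<mu> * g i x * E x"
    and g: "\<And>i x. cmod (g i x) \<le> G"
    and w: "\<And>i. periodic (w i)"
    and gw: "\<And>x. (\<Sum>i\<in>UNIV. g i x * w i x) = 1"
    and \<mu>: "\<mu> > 0"
  shows "periodic a \<Longrightarrow> derivs_bounded r A a \<Longrightarrow> (\<And>i. derivs_bounded r W (w i)) \<Longrightarrow>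
    cmod (\<integral>x. E x * a x \<partial>torus_measure) \<le> A * (\<Prod>s<r. real CARD('n) * (2 ^ Suc s * W)) / \<mu> ^ r"
proof (induction r arbitrary: a A)
  case 0
  have "cmod (E x * a x) \<le> 1 * A" for x
    unfolding norm_mult using derivs_bounded_norm_le[OF 0(2)] by (intro mult_mono E(3)) auto
  then have "cmod (\<integral>x. E x * a x \<partial>torus_measure) \<le> 1 * A"
    by (rule norm_integral_torus_le)
  then show ?case
    by simp
next
  case (Suc r)
  define b where "b = (\<lambda>x. \<Sum>i\<in>UNIV. pderiv_dir i (\<lambda>x. a x * w i x) x)"
  note ibp = integral_by_parts_phase[OF E dE g Suc.prems(1,2) w Suc.prems(3) gw \<mu> b_def]
  have "cmod (\<integral>x. E x * a x \<partial>torus_measure) = cmod (\<integral>x. E x * b x \<partial>torus_measure) / \<mu>"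
    unfolding ibp(1) using \<mu> by (simp add: norm_mult norm_divide)
  also have "\<dots> \<le> (real CARD('n) * (2 ^ Suc r * (A * W))) * (\<Prod>s<r. real CARD('n) * (2 ^ Suc s * W)) / \<mu> ^ r / \<mu>"
    using \<mu> by (intro divide_right_mono Suc.IH ibp derivs_bounded_SucD[OF Suc.prems(3)]) auto
  also have "\<dots> = A * (\<Prod>s<Suc r. real CARD('n) * (2 ^ Suc s * W)) / \<mu> ^ Suc r"
    by (simp add: mult_ac)
  finally show ?case .
qed

section \<open>Schur's test, duality, and the matrix of the operator\<close>

lemma eq_cmod_if_of_real_eq: "complex_of_real X = z \<Longrightarrow> 0 \<le> X \<Longrightarrow> X = cmod z"
  by auto

text \<open>Expanding the square gives the Gram matrix. With |c_k| |c_l| \<le> (|c_k|^2 + |c_l|^2) /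
  2 and the evenness of the weight both halves become the same sum, in which every row of the weight
  contributes at most 4^n.\<close>

lemma Schur_bound:
  fixes s :: "int ^ 'n \<Rightarrow> real ^ 'n \<Rightarrow> complex"
  assumes s: "\<And>k. s k \<in> borel_measurable torus_measure" "\<And>k x. cmod (s k x) \<le> B k"
    and K: "\<And>k l. cmod (torus_inner (s k) (s l)) \<le> K * lattice_decay (k - l)"
    and F: "finite F"
  shows "(\<integral>x. (cmod (\<Sum>k\<in>F. c k * s k x))\<^sup>2 \<partial>torus_measure) \<le> K * 4 ^ CARD('n) * (\<Sum>k\<in>F. (cmod (c k))\<^sup>2)"
proof -
  have K0: "0 \<le> K"
    using order_trans[OF norm_ge_zero K[of 0 0]] lattice_decay_pos[of "0 :: int ^ 'n"]
    by (simp add: zero_le_mult_iff)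
  have si: "integrable torus_measure (\<lambda>x. s k x * cnj (s l x))" for k l
    using integrable_mult_bounded[OF integrable_torus_bounded[OF s], of "\<lambda>x. cnj (s l x)" "B l"] s
    by (auto intro: borel_measurable_cnj)
  have "complex_of_real (\<integral>x. (cmod (\<Sum>k\<in>F. c k * s k x))\<^sup>2 \<partial>torus_measure) =
      (\<integral>x. (\<Sum>k\<in>F. \<Sum>l\<in>F. c k * cnj (c l) * (s k x * cnj (s l x))) \<partial>torus_measure)"
    unfolding integral_complex_of_real[symmetric] complex_norm_square
    by (simp add: sum_product mult_ac)
  also have "\<dots> = (\<Sum>k\<in>F. \<Sum>l\<in>F. c k * cnj (c l) * torus_inner (s k) (s l))"
    using si by (simp add: Bochner_Integration.integral_sum torus_inner_def)
  finally have "(\<integral>x. (cmod (\<Sum>k\<in>F. c k * s k x))\<^sup>2 \<partial>torus_measure)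
      = cmod (\<Sum>k\<in>F. \<Sum>l\<in>F. c k * cnj (c l) * torus_inner (s k) (s l))"
    by (rule eq_cmod_if_of_real_eq) simp
  also have "\<dots> \<le> (\<Sum>k\<in>F. \<Sum>l\<in>F. cmod (c k) * cmod (c l) * (K * lattice_decay (k - l)))"
    by (intro sum_norm_le) (auto simp: norm_mult intro!: mult_left_mono K)
  also have "\<dots> \<le> (\<Sum>k\<in>F. \<Sum>l\<in>F. ((cmod (c k))\<^sup>2 + (cmod (c l))\<^sup>2) / 2 * (K * lattice_decay (k - l)))"
  proof (intro sum_mono mult_right_mono)
    fix k l
    show "cmod (c k) * cmod (c l) \<le> ((cmod (c k))\<^sup>2 + (cmod (c l))\<^sup>2) / 2"
      using sum_squares_bound[of "cmod (c k)" "cmod (c l)"] by simp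
  qed (auto intro!: mult_nonneg_nonneg K0 less_imp_le[OF lattice_decay_pos])
  also have "\<dots> = K / 2 * ((\<Sum>k\<in>F. \<Sum>l\<in>F. (cmod (c k))\<^sup>2 * lattice_decay (k - l)) +
      (\<Sum>k\<in>F. \<Sum>l\<in>F. (cmod (c l))\<^sup>2 * lattice_decay (k - l)))"
    by (simp add: sum.distrib[symmetric] sum_distrib_left field_simps)
  also have "(\<Sum>k\<in>F. \<Sum>l\<in>F. (cmod (c l))\<^sup>2 * lattice_decay (k - l)) =
      (\<Sum>k\<in>F. \<Sum>l\<in>F. (cmod (c k))\<^sup>2 * lattice_decay (k - l))"
    by (subst sum.swap) (intro sum.cong refl arg_cong2[where f = "(*)"] lattice_decay_commute)
  also have "K / 2 * ((\<Sum>k\<in>F. \<Sum>l\<in>F. (cmod (c k))\<^sup>2 * lattice_decay (k - l)) +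
      (\<Sum>k\<in>F. \<Sum>l\<in>F. (cmod (c k))\<^sup>2 * lattice_decay (k - l))) =
      K * (\<Sum>k\<in>F. \<Sum>l\<in>F. (cmod (c k))\<^sup>2 * lattice_decay (k - l))"
    by simp
  also have "\<dots> \<le> K * (\<Sum>k\<in>F. (cmod (c k))\<^sup>2 * 4 ^ CARD('n))"
  proof (rule mult_left_mono[OF sum_mono K0])
    fix k
    have "(\<Sum>l\<in>F. lattice_decay (k - l)) = sum lattice_decay ((\<lambda>l. k - l) ` F)"
      by (subst sum.reindex) (auto simp: inj_on_def)
    also have "\<dots> \<le> 4 ^ CARD('n)"
      using F by (intro sum_lattice_decay_le) auto
    finally show "(\<Sum>l\<in>F. (cmod (c k))\<^sup>2 * lattice_decay (k - l)) \<le> (cmod (c k))\<^sup>2 * 4 ^ CARD('n)"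
      unfolding sum_distrib_left[symmetric] by (intro mult_left_mono) auto
  qed
  finally show ?thesis
    by (simp add: sum_distrib_left sum_distrib_right mult_ac)
qed

text \<open>The matrix is the transpose of that of the map from c to the Fourier coefficients of
  \<Sum> c k * s k. With coefficients \<open>cnj (A f k)\<close> over a finite \<open>F\<close>, the
  sum \<open>X\<close> to be estimated is the pairing of \<open>f\<close> with the Fourier
  coefficients of \<open>V\<close>, whose squared norm is at most \<open>S * X\<close>. Finiteness
  of \<open>F\<close> keeps \<open>X\<close> meaningful before \<open>A f\<close> is known to be in
  \<open>ell2\<close>.\<close>

lemma bounded_operator_almost_orthogonal:
  fixes s :: "int ^ 'n \<Rightarrow> real ^ 'n \<Rightarrow> complex"
  assumes s: "\<And>k. s k \<in> borel_measurable torus_measure" "\<And>k x. cmod (s k x) \<le> B k"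
    and K: "\<And>k l. cmod (torus_inner (s k) (s l)) \<le> K * lattice_decay (k - l)"
  shows "bounded_operator_ell2 (\<lambda>f k. \<Sum>\<^sub>\<infinity>l. F_torus (s k) l * f l)"
proof -
  define A where "A f k = (\<Sum>\<^sub>\<infinity>l. F_torus (s k) l * f l)" for f k
  \<comment> \<open>The summand 1 makes \<open>S\<close> positive even for \<open>K = 0\<close>,
    since \<open>S\<close> will be divided by.\<close>
  define S where "S = K * 4 ^ CARD('n) + 1"
  have "0 \<le> K"
    using order_trans[OF norm_ge_zero K[of 0 0]] lattice_decay_pos[of "0 :: int ^ 'n"]
    by (simp add: zero_le_mult_iff)
  then have S: "S > 0"
    by (simp add: S_def add_nonneg_pos)
  have sL: "integrable torus_measure (\<lambda>x. (cmod (s k x))\<^sup>2)" for k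
    by (rule integrable_torus_bounded[where B = "(B k)\<^sup>2"]) (use s in \<open>auto intro!: power_mono\<close>)
  have si: "integrable torus_measure (s k)" for k
    by (rule integrable_torus_bounded[OF s])
  have sm: "(\<lambda>l. F_torus (s k) l * f l) summable_on UNIV" if "f \<in> ell2" for f k
    by (rule abs_summable_summable, rule ell2_mult_summable[OF Bessel_ell2(1)[OF s(1) sL] that])
  have bound: "(\<Sum>k\<in>F. (cmod (A f k))\<^sup>2) \<le> S * (\<Sum>\<^sub>\<infinity>k. (cmod (f k))\<^sup>2)"
    if f: "f \<in> ell2" and F: "finite F" for f F
  proof -
    define X where "X = (\<Sum>k\<in>F. (cmod (A f k))\<^sup>2)"
    define Y where "Y = (\<Sum>\<^sub>\<infinity>k. (cmod (f k))\<^sup>2)"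
    define V where "V x = (\<Sum>k\<in>F. cnj (A f k) * s k x)" for x
    have Vm: "V \<in> borel_measurable torus_measure"
      unfolding V_def[abs_def] using s(1) by measurable
    have Vb: "cmod (V x) \<le> (\<Sum>k\<in>F. cmod (A f k) * B k)" for x
      unfolding V_def by (rule sum_norm_le) (auto simp: norm_mult intro!: mult_left_mono s)
    have V2: "integrable torus_measure (\<lambda>x. (cmod (V x))\<^sup>2)"
      by (rule integrable_torus_bounded[where B = "(\<Sum>k\<in>F. cmod (A f k) * B k)\<^sup>2"])
         (use Vm Vb in \<open>auto intro!: power_mono\<close>)
    have FV: "F_torus V l = (\<Sum>k\<in>F. cnj (A f k) * F_torus (s k) l)" for l
    proof -
      have "integrable torus_measure (\<lambda>x. s k x * cnj (char l x))" for k
        by (rule integrable_mult_bounded[OF si, of _ 1])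
           (auto simp: cnj_char intro!: borel_measurable_torus continuous_char)
      then have i: "integrable torus_measure (\<lambda>x. cnj (A f k) * (s k x * cnj (char l x)))" for k
        by simp
      have "F_torus V l = (\<integral>x. (\<Sum>k\<in>F. cnj (A f k) * (s k x * cnj (char l x))) \<partial>torus_measure)"
        unfolding F_torus_conv_inner torus_inner_def V_def by (simp add: sum_distrib_right sum_distrib_left mult_ac)
      also have "\<dots> = (\<Sum>k\<in>F. cnj (A f k) * F_torus (s k) l)"
        unfolding F_torus_conv_inner torus_inner_def
        by (subst Bochner_Integration.integral_sum[OF i]) simp
      finally show ?thesis .
    qed
    note FL = Bessel_ell2(1)[OF Vm V2]
    have VX: "(\<Sum>\<^sub>\<infinity>l. (cmod (F_torus V l))\<^sup>2) \<le> S * X"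
    proof -
      have "(\<Sum>\<^sub>\<infinity>l. (cmod (F_torus V l))\<^sup>2) \<le> (\<integral>x. (cmod (V x))\<^sup>2 \<partial>torus_measure)"
        by (rule Bessel_ell2(2)[OF Vm V2])
      also have "\<dots> \<le> K * 4 ^ CARD('n) * X"
        using Schur_bound[OF s K F, of "\<lambda>k. cnj (A f k)"] by (simp add: V_def X_def)
      also have "\<dots> \<le> S * X"
        by (simp add: S_def X_def sum_nonneg algebra_simps)
      finally show ?thesis .
    qed
    have "complex_of_real X = (\<Sum>k\<in>F. cnj (A f k) * A f k)"
      unfolding X_def of_real_sum complex_norm_square by (simp add: mult.commute)
    also have "\<dots> = (\<Sum>k\<in>F. \<Sum>\<^sub>\<infinity>l. cnj (A f k) * (F_torus (s k) l * f l))"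
      unfolding A_def[of f] by (simp add: infsum_cmult_right')
    also have "\<dots> = (\<Sum>\<^sub>\<infinity>l. \<Sum>k\<in>F. cnj (A f k) * (F_torus (s k) l * f l))"
      by (rule infsum_sum[symmetric]) (intro summable_on_cmult_right sm f)
    also have "\<dots> = (\<Sum>\<^sub>\<infinity>l. F_torus V l * f l)"
      unfolding FV by (simp add: sum_distrib_right sum_distrib_left mult_ac)
    finally have "X = cmod (\<Sum>\<^sub>\<infinity>l. F_torus V l * f l)"
      by (rule eq_cmod_if_of_real_eq) (simp add: X_def sum_nonneg)
    also have "\<dots> \<le> (\<Sum>\<^sub>\<infinity>l. cmod (F_torus V l * f l))"
      by (rule norm_infsum_bound[OF ell2_mult_summable[OF FL f]])
    \<comment> \<open>AM-GM with weights chosen so that half of \<open>X\<close> can be absorbed on the left\<close>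
    also have "\<dots> \<le> (\<Sum>\<^sub>\<infinity>l. (1 / (2 * S)) * (cmod (F_torus V l))\<^sup>2 + (S / 2) * (cmod (f l))\<^sup>2)"
    proof (rule infsum_mono[OF ell2_mult_summable[OF FL f]])
      show "(\<lambda>l. (1 / (2 * S)) * (cmod (F_torus V l))\<^sup>2 + (S / 2) * (cmod (f l))\<^sup>2) summable_on UNIV"
        using FL f unfolding ell2_def by (intro summable_on_add summable_on_cmult_right) auto
      fix l
      have "2 * (cmod (F_torus V l)) * (S * cmod (f l)) \<le> (cmod (F_torus V l))\<^sup>2 + (S * cmod (f l))\<^sup>2"
        by (rule sum_squares_bound)
      then show "cmod (F_torus V l * f l) \<le> (1 / (2 * S)) * (cmod (F_torus V l))\<^sup>2 + (S / 2) * (cmod (f l))\<^sup>2"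
        using S by (simp add: norm_mult field_simps power2_eq_square)
    qed
    also have "\<dots> = (1 / (2 * S)) * (\<Sum>\<^sub>\<infinity>l. (cmod (F_torus V l))\<^sup>2) + (S / 2) * Y"
      using FL f unfolding ell2_def Y_def mem_Collect_eq
      by (simp only: infsum_add summable_on_cmult_right infsum_cmult_right')
    also have "\<dots> \<le> (1 / (2 * S)) * (S * X) + (S / 2) * Y"
      using S by (intro add_right_mono mult_left_mono VX) auto
    finally show ?thesis
      using S unfolding X_def[symmetric] Y_def[symmetric] by simp
  qed
  have ell: "A f \<in> ell2" if "f \<in> ell2" for f
    unfolding ell2_def mem_Collect_eq
    by (rule nonneg_bdd_above_summable_on) (auto intro!: bdd_aboveI2 bound[OF that])
  have "ell2_norm (A f) \<le> sqrt S * ell2_norm f" if "f \<in> ell2" for f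
  proof -
    have "(\<Sum>\<^sub>\<infinity>k. (cmod (A f k))\<^sup>2) \<le> S * (\<Sum>\<^sub>\<infinity>k. (cmod (f k))\<^sup>2)"
      using ell[OF that] by (intro infsum_le_finite_sums bound[OF that]) (auto simp: ell2_def)
    then show ?thesis
      unfolding ell2_norm_def by (simp flip: real_sqrt_mult)
  qed
  moreover have "A (\<lambda>k. f k + g k) = (\<lambda>k. A f k + A g k)" if "f \<in> ell2" "g \<in> ell2" for f g
    unfolding A_def using infsum_add[OF sm[OF that(1)] sm[OF that(2)]]
    by (simp add: distrib_left)
  moreover have "A (\<lambda>k. c * f k) = (\<lambda>k. c * A f k)" for c f
    unfolding A_def infsum_cmult_right'[symmetric] by (simp add: mult_ac)
  ultimately have "bounded_operator_ell2 A"
    using ell unfolding bounded_operator_ell2_def by blast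
  then show ?thesis
    by (simp add: A_def[abs_def])
qed

text \<open>Absolute summability of a rapidly decreasing \<open>f\<close> allows sum and integral to
  be interchanged, so the matrix operator, defined on all of \<open>ell2\<close>, extends
  \<open>T_lattice \<phi> \<sigma>\<close>.\<close>

lemma T_lattice_eq_matrix:
  fixes f :: "int ^ 'n \<Rightarrow> complex"
  assumes f: "f \<in> schwartz_lattice"
    and s: "(\<lambda>x. exp (\<i> * of_real (\<phi> k x)) * \<sigma> k x) \<in> borel_measurable torus_measure"
      "\<And>x. cmod (\<sigma> k x) \<le> B"
  shows "T_lattice \<phi> \<sigma> f k = (\<Sum>\<^sub>\<infinity>l. F_torus (\<lambda>x. exp (\<i> * of_real (\<phi> k x)) * \<sigma> k x) l * f l)"
proof -
  define t where "t x = exp (\<i> * of_real (\<phi> k x)) * \<sigma> k x" for x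
  have tm: "t \<in> borel_measurable torus_measure"
    using s(1) by (simp add: t_def[abs_def])
  have tB: "cmod (t x) \<le> B" for x
    using s(2) by (simp add: t_def norm_mult)
  define g where "g l x = t x * char (- l) x * f l" for l x
  have gn: "cmod (g l x) \<le> B * cmod (f l)" for l x
    using tB by (auto simp: g_def norm_mult intro!: mult_right_mono)
  have B0: "B \<ge> 0"
    using order_trans[OF norm_ge_zero tB] .
  have gi: "integrable torus_measure (g l)" for l
    by (rule integrable_torus_bounded[OF _ gn]) (auto simp: g_def[abs_def] intro!: tm
          borel_measurable_times borel_measurable_torus[OF continuous_char])
  have sB: "(\<lambda>l. B * cmod (f l)) summable_on UNIV"
    by (intro summable_on_cmult_right schwartz_lattice_summable f)
  have sum: "t x * F_lattice f x = (\<Sum>\<^sub>\<infinity>l. g l x)" for x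
    unfolding F_lattice_conv_char g_def infsum_cmult_right'[symmetric] by (simp add: mult_ac)
  have "T_lattice \<phi> \<sigma> f k = (\<integral>x. (\<Sum>\<^sub>\<infinity>l. g l x) \<partial>torus_measure)"
    unfolding T_lattice_def sum[symmetric] t_def ..
  also have "\<dots> = (\<Sum>\<^sub>\<infinity>l. \<integral>x. g l x \<partial>torus_measure)"
  proof (rule integral_infsum_lattice[OF gi])
    show "AE x in torus_measure. (\<lambda>l. cmod (g l x)) summable_on UNIV"
      by (intro always_eventually allI summable_on_comparison_test[OF sB] gn) auto
    show "(\<lambda>x. \<Sum>\<^sub>\<infinity>l. g l x) \<in> borel_measurable torus_measure"
      unfolding sum[symmetric] by (intro borel_measurable_times tm borel_measurable_F_lattice f)
    have "norm (\<integral>x. cmod (g l x) \<partial>torus_measure) \<le> B * cmod (f l)" for l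
      using gn by (intro norm_integral_torus_le) auto
    then show "(\<lambda>l. \<integral>x. cmod (g l x) \<partial>torus_measure) summable_on UNIV"
      by (intro summable_on_comparison_test[OF sB]) auto
  qed
  also have "\<dots> = (\<Sum>\<^sub>\<infinity>l. F_torus t l * f l)"
    unfolding g_def F_torus_def exp_eq_char_uminus by (simp add: mult_ac)
  finally show ?thesis
    by (simp add: t_def[abs_def])
qed

text \<open>The inner product is the integral of \<open>E * a\<close> with
  \<open>E = e k * cnj (e l)\<close> and \<open>a = \<sigma> k * cnj (\<sigma> l)\<close>. The large
  parameter is \<mu> = |k - l|, and the rescaled phase gradient \<open>g\<close> has length at least
  \<open>c\<close>, so g / |g|^2 is a dual field with bounded derivatives.\<close>

lemma oscillatory_kernel_decay:
  fixes \<phi> :: "int ^ 'n \<Rightarrow> real ^ 'n \<Rightarrow> real"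
    and \<sigma> :: "int ^ 'n \<Rightarrow> real ^ 'n \<Rightarrow> complex"
  defines "s \<equiv> (\<lambda>k x. exp (\<i> * of_real (\<phi> k x)) * \<sigma> k x)"
  assumes per: "\<And>k. periodic (\<lambda>x. exp (\<i> * complex_of_real (\<phi> k x)))"
    and \<sigma>: "\<And>k. periodic (\<sigma> k)" "\<And>k. derivs_bounded (2 * CARD('n)) C1 (\<sigma> k)"
    and \<phi>: "\<And>k x. \<phi> k differentiable (at x)"
    and \<Delta>: "\<And>k j. times_differentiable (2 * CARD('n) + 1) (Delta j \<phi> k)"
      "\<And>\<alpha> j k x. length \<alpha> \<le> 2 * CARD('n) + 1 \<Longrightarrow> x \<in> unit_cube \<Longrightarrow> \<bar>pderivs \<alpha> (Delta j \<phi> k) x\<bar> \<le> C2"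
    and c: "c > 0" "\<And>x k l. x \<in> unit_cube \<Longrightarrow> norm (grad (\<phi> k) x - grad (\<phi> l) x) \<ge> c * norm (lat k - lat l)"
  shows "\<exists>K. \<forall>k l. cmod (torus_inner (s k) (s l)) \<le> K * lattice_decay (k - l)"
proof -
  define e where "e k x = exp (\<i> * complex_of_real (\<phi> k x))" for k x
  define u where "u i k = pderiv_dir i (\<phi> k)" for i k
  have e0: "e k x \<noteq> 0" "cmod (e k x) = 1" for k x
    by (simp_all add: e_def)
  have e_der: "e k differentiable (at x)" "pderiv_dir i (e k) x = \<i> * of_real (u i k x) * e k x" for i k x
  proof -
    obtain \<phi>' where d: "(\<phi> k has_derivative \<phi>') (at x)"
      using \<phi> unfolding differentiable_def by blast
    have "((\<lambda>y. \<i> * complex_of_real (\<phi> k y)) has_derivative (\<lambda>h. \<i> * of_real (\<phi>' h))) (at x)"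
      by (intro has_derivative_mult_right has_derivative_of_real d)
    from has_derivative_compose[OF this DERIV_exp[THEN has_field_derivative_imp_has_derivative]]
    have *: "(e k has_derivative (\<lambda>h. e k x * (\<i> * of_real (\<phi>' h)))) (at x)"
      by (simp add: e_def[abs_def])
    show "e k differentiable (at x)"
      using * unfolding differentiable_def by blast
    show "pderiv_dir i (e k) x = \<i> * of_real (u i k x) * e k x"
      unfolding u_def pderiv_dir_eq[OF *] pderiv_dir_eq[OF d] by simp
  qed
  \<comment> \<open>Only \<open>e k\<close> is periodic, not \<open>\<phi> k\<close>; but the gradient of \<open>\<phi> k\<close> is, up to
    a factor \<open>\<i>\<close>, the logarithmic derivative of \<open>e k\<close>.\<close>
  have pu: "u i k (x + lat m) = u i k x" for i k x m
  proof -
    have "pderiv_dir i (e k) (x + lat m) = pderiv_dir i (e k) x" "e k (x + lat m) = e k x"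
      using per periodic_pderiv_dir[OF per] unfolding periodic_def e_def[abs_def] by blast+
    then show ?thesis
      using e0(1)[of k x] by (simp add: e_der(2))
  qed
  have step: "derivs_bounded (2 * CARD('n)) C2 (\<lambda>x. u i (k + axis j 1) x - u i k x)" for i j k
  proof -
    have "pderiv_dir i (Delta j \<phi> k) x = u i (k + axis j 1) x - u i k x" for x
    proof -
      obtain f' g' where "(\<phi> (k + axis j 1) has_derivative f') (at x)" "(\<phi> k has_derivative g') (at x)"
        using \<phi> unfolding differentiable_def by meson
      then show ?thesis
        unfolding u_def Delta_def[abs_def] by (simp add: pderiv_dir_eq pderiv_dir_eq[OF has_derivative_diff])
    qed
    then have eq: "(\<lambda>x. u i (k + axis j 1) x - u i k x) = pderiv_dir i (Delta j \<phi> k)"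
      by (simp add: fun_eq_iff)
    show ?thesis
    proof (rule derivs_boundedI)
      show "periodic (\<lambda>x. u i (k + axis j 1) x - u i k x)"
        by (simp add: periodic_def pu)
      show "times_differentiable (2 * CARD('n)) (\<lambda>x. u i (k + axis j 1) x - u i k x)"
        using \<Delta>(1)[of j k] by (simp add: eq)
      show "norm (pderivs \<alpha> (\<lambda>x. u i (k + axis j 1) x - u i k x) x) \<le> C2"
        if "length \<alpha> \<le> 2 * CARD('n)" "x \<in> unit_cube" for \<alpha> x
        using \<Delta>(2)[of "\<alpha> @ [i]" x j k] that by (simp add: pderivs_append eq)
    qed
  qed
  have C2: "C2 \<ge> 0"
    using step[THEN derivs_bounded_nonneg] .
  define N where "N = 2 * CARD('n)"
  \<comment> \<open>The factor n compares the l^1 length of k - l, which counts unit steps, with its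
    Euclidean length.\<close>
  define G where "G = C2 * real CARD('n)"
  \<comment> \<open>Chosen before \<open>k\<close> and \<open>l\<close>, so that \<open>BI\<close>,
    \<open>W\<close> and \<open>Q\<close> are the same for all pairs.\<close>
  obtain BI where BI: "\<And>f :: real ^ 'n \<Rightarrow> real. derivs_bounded N (real CARD('n) * (2 ^ N * (G * G))) f \<Longrightarrow>
      (\<And>x. c\<^sup>2 \<le> norm (f x)) \<Longrightarrow> derivs_bounded N BI (\<lambda>x. inverse (f x))"
    using derivs_bounded_inverse[of "c\<^sup>2" N "real CARD('n) * (2 ^ N * (G * G))", where 'a = real and 'n = 'n] c(1)
    by auto
  define W where "W = 2 ^ N * (G * BI)"
  define Q where "Q = 2 ^ N * (C1 * C1) * (\<Prod>s<N. real CARD('n) * (2 ^ Suc s * W))"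
  have off_diag: "cmod (torus_inner (s k) (s l)) \<le> Q / norm (lat k - lat l) ^ N" if "k \<noteq> l" for k l
  proof -
    define \<mu> where "\<mu> = norm (lat k - lat l)"
    have \<mu>: "\<mu> > 0"
      using that by (auto simp: \<mu>_def lat_def vec_eq_iff)
    define E where "E x = e k x * cnj (e l x)" for x
    define g where "g i x = (u i k x - u i l x) / \<mu>" for i x
    have g: "derivs_bounded N G (g i)" for i
    proof -
      have "real (\<Sum>i\<in>UNIV. nat \<bar>k $ i - l $ i\<bar>) = (\<Sum>i\<in>UNIV. \<bar>(lat k - lat l) $ i\<bar>)"
        by (simp add: lat_def)
      also have "\<dots> \<le> (\<Sum>i\<in>(UNIV :: 'n set). \<mu>)"
        unfolding \<mu>_def by (intro sum_mono component_le_norm_cart)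
      finally have "C2 * real (\<Sum>i\<in>UNIV. nat \<bar>k $ i - l $ i\<bar>) \<le> G * \<mu>"
        using C2 by (simp add: G_def mult_left_mono mult.assoc)
      then have "derivs_bounded N (G * \<mu>) (\<lambda>x. u i k x - u i l x)"
        unfolding N_def by (rule derivs_bounded_mono[OF derivs_bounded_lattice_diff[OF step]])
      then have "derivs_bounded N (1 / \<mu> * (G * \<mu>)) (\<lambda>x. (u i k x - u i l x) / \<mu>)"
        by (rule derivs_bounded_linear[OF bounded_linear_divide, rotated 2]) (use \<mu> in auto)
      then show ?thesis
        using \<mu> by (simp add: g_def[abs_def])
    qed
    define S where "S x = (\<Sum>i\<in>UNIV. g i x * g i x)" for x
    have S: "derivs_bounded N (real CARD('n) * (2 ^ N * (G * G))) S"
      unfolding S_def[abs_def] by (intro derivs_bounded_sum derivs_bounded_mult g)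
    have gp: "g i (x + lat m) = g i x" for i x m
      by (simp add: g_def pu)
    have Sp: "S (x + lat m) = S x" for x m
      by (simp add: S_def gp)
    \<comment> \<open>The gradient condition is given on the cube only; as \<open>S\<close> is
      periodic, it is enough to use it at a translate of \<open>x\<close>.\<close>
    have Sc: "c\<^sup>2 \<le> S x" for x
    proof -
      obtain m where m: "x + lat m \<in> unit_cube" (is "?y \<in> _")
        using ex_add_lat_in_cube by blast
      have "(c * \<mu>)\<^sup>2 \<le> (norm (grad (\<phi> k) ?y - grad (\<phi> l) ?y))\<^sup>2"
        unfolding \<mu>_def using c(1) by (intro power_mono c(2) m) auto
      also have "\<dots> = (\<Sum>i\<in>UNIV. (u i k ?y - u i l ?y)\<^sup>2)"
        unfolding power2_norm_eq_inner by (simp add: inner_vec_def grad_def u_def power2_eq_square)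
      also have "\<dots> = \<mu>\<^sup>2 * S ?y"
        using \<mu> by (simp add: S_def g_def sum_distrib_left power2_eq_square)
      finally show ?thesis
        using \<mu> by (simp add: Sp power_mult_distrib)
    qed
    then have S0: "S x \<noteq> 0" for x
      using c(1) by (metis not_le zero_less_power2 less_irrefl)
    \<comment> \<open>\<open>S\<close> is |g|^2, so this is the shortest field whose inner product
      with \<open>g\<close> is 1.\<close>
    define w where "w i x = g i x * inverse (S x)" for i x
    have iS: "derivs_bounded N BI (\<lambda>x. inverse (S x))"
      using S Sc by (intro BI) (auto intro: order_trans[OF _ abs_ge_self])
    then have w: "derivs_bounded N W (w i)" for i
      unfolding w_def[abs_def] W_def by (intro derivs_bounded_mult g)
    have wc: "derivs_bounded N (1 * W) (\<lambda>x. complex_of_real (w i x))" for i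
      by (intro derivs_bounded_linear bounded_linear_of_real w) auto
    have gw: "(\<Sum>i\<in>UNIV. complex_of_real (g i x) * complex_of_real (w i x)) = 1" for x
    proof -
      have "(\<Sum>i\<in>UNIV. g i x * w i x) = S x * inverse (S x)"
        by (simp add: w_def S_def sum_distrib_right mult.assoc)
      then have "(\<Sum>i\<in>UNIV. g i x * w i x) = 1"
        using S0 by simp
      then show ?thesis
        by (metis (no_types, lifting) of_real_1 of_real_mult of_real_sum sum.cong)
    qed
    define a where "a x = \<sigma> k x * cnj (\<sigma> l x)" for x
    have "derivs_bounded N (1 * C1) (\<lambda>x. cnj (\<sigma> l x))"
      using \<sigma>(2)[of l] unfolding N_def by (intro derivs_bounded_linear bounded_linear_cnj) auto
    then have a: "derivs_bounded N (2 ^ N * (C1 * C1)) a"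
      unfolding a_def[abs_def] using \<sigma>(2)[of k] by (intro derivs_bounded_mult) (simp_all add: N_def)
    have cd: "(\<lambda>x. cnj (e l x)) differentiable (at x)" for x
      using e_der(1)[of l x] bounded_linear.has_derivative[OF bounded_linear_cnj]
      unfolding differentiable_def by blast
    have dE: "pderiv_dir i E x = \<i> * of_real \<mu> * complex_of_real (g i x) * E x" for i x
      unfolding E_def[abs_def] pderiv_dir_mult[OF e_der(1) cd]
        pderiv_dir_bounded_linear[OF bounded_linear_cnj e_der(1)] e_der(2)
      using \<mu> by (simp add: g_def field_simps)
    have "cmod (\<integral>x. E x * a x \<partial>torus_measure) \<le> 2 ^ N * (C1 * C1) * (\<Prod>s<N. real CARD('n) * (2 ^ Suc s * W)) / \<mu> ^ N"
    proof (rule nonstationary_phase[where G = G and g = "\<lambda>i x. of_real (g i x)" and w = "\<lambda>i x. of_real (w i x)"])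
      show "periodic E"
        using per unfolding periodic_def E_def e_def by simp
      show "E differentiable (at x)" for x
        unfolding E_def[abs_def] by (rule differentiable_mult[OF e_der(1) cd])
      show "cmod (E x) \<le> 1" for x
        by (simp add: E_def norm_mult e0)
      show "cmod (complex_of_real (g i x)) \<le> G" for i x
        using derivs_bounded_norm_le[OF g, of i x] by simp
      show "periodic (\<lambda>x. complex_of_real (w i x))" for i
        by (simp add: periodic_def w_def gp Sp)
      show "periodic a"
        using \<sigma>(1) by (simp add: periodic_def a_def)
    qed (use dE gw \<mu> a wc in simp_all)
    moreover have "torus_inner (s k) (s l) = (\<integral>x. E x * a x \<partial>torus_measure)"
      unfolding torus_inner_def s_def E_def a_def e_def by (simp add: mult_ac)
    ultimately show ?thesis
      by (simp add: Q_def \<mu>_def)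
  qed
  \<comment> \<open>On the diagonal the weight is 1 and the trivial bound \<open>C1 * C1\<close> is
    used. Distinct lattice points have distance \<mu> \<ge> 1, so 1 + \<mu> \<le> 2 \<mu>, which
    costs the factor \<open>2 ^ N\<close>.\<close>
  have "cmod (torus_inner (s k) (s l)) \<le> (C1 * C1 + \<bar>Q\<bar> * 2 ^ N) * lattice_decay (k - l)" for k l
  proof (cases "k = l")
    case True
    have "cmod (s k x * cnj (s l x)) \<le> C1 * C1" for x
      using derivs_bounded_norm_le[OF \<sigma>(2)] derivs_bounded_nonneg[OF \<sigma>(2)]
      by (auto simp: s_def norm_mult intro!: mult_mono)
    then have "cmod (torus_inner (s k) (s l)) \<le> C1 * C1"
      unfolding torus_inner_def by (rule norm_integral_torus_le)
    moreover have "lattice_decay (k - l) = 1"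
      using True by (simp add: lattice_decay_def)
    ultimately show ?thesis
      by (simp add: add_increasing2)
  next
    case False
    define \<mu> where "\<mu> = norm (lat (k - l))"
    have \<mu>: "\<mu> \<ge> 1"
    proof -
      obtain i where "k $ i \<noteq> l $ i"
        using False by (auto simp: vec_eq_iff)
      then have "1 \<le> \<bar>lat (k - l) $ i\<bar>"
        by (simp add: lat_def)
      also have "\<dots> \<le> \<mu>"
        unfolding \<mu>_def by (rule component_le_norm_cart)
      finally show ?thesis .
    qed
    have "cmod (torus_inner (s k) (s l)) \<le> \<bar>Q\<bar> * (1 / \<mu> ^ N)"
      using order_trans[OF off_diag[OF False] divide_right_mono[OF abs_ge_self]]
      by (simp add: \<mu>_def lat_diff)
    also have "1 / \<mu> ^ N \<le> 2 ^ N * lattice_decay (k - l)"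
    proof -
      have "(1 + \<mu>) ^ N \<le> (2 * \<mu>) ^ N"
        using \<mu> by (intro power_mono) auto
      then have "1 / \<mu> ^ N \<le> 2 ^ N * (1 / (1 + \<mu>) ^ N)"
        using \<mu> by (simp add: field_simps power_mult_distrib)
      also have "\<dots> \<le> 2 ^ N * lattice_decay (k - l)"
        unfolding \<mu>_def N_def by (intro mult_left_mono inverse_norm_power_le_decay) auto
      finally show ?thesis .
    qed
    finally have "cmod (torus_inner (s k) (s l)) \<le> \<bar>Q\<bar> * (2 ^ N * lattice_decay (k - l))"
      by (simp add: mult_left_mono)
    also have "\<dots> \<le> (C1 * C1 + \<bar>Q\<bar> * 2 ^ N) * lattice_decay (k - l)"
      using mult_nonneg_nonneg[OF zero_le_square[of C1] less_imp_le[OF lattice_decay_pos[of "k - l"]]]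
      by (simp add: algebra_simps)
    finally show ?thesis .
  qed
  then show ?thesis
    by blast
qed

section \<open>The bounded extension, and both statements together\<close>

lemma T_lattice_extends:
  fixes \<phi> :: "int ^ 'n \<Rightarrow> real ^ 'n \<Rightarrow> real"
    and \<sigma> :: "int ^ 'n \<Rightarrow> real ^ 'n \<Rightarrow> complex"
  assumes per: "\<And>k. periodic (\<lambda>x. exp (\<i> * complex_of_real (\<phi> k x)))" "\<And>k. periodic (\<sigma> k)"
    and \<sigma>: "\<And>k. times_differentiable (2 * CARD('n) + 1) (\<sigma> k)"
      "\<And>\<alpha> k x. length \<alpha> \<le> 2 * CARD('n) + 1 \<Longrightarrow> x \<in> unit_cube \<Longrightarrow> cmod (pderivs \<alpha> (\<sigma> k) x) \<le> C1"
    and \<phi>: "\<And>k x. \<phi> k differentiable (at x)"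
    and \<Delta>: "\<And>k j. times_differentiable (2 * CARD('n) + 1) (Delta j \<phi> k)"
      "\<And>\<alpha> j k x. length \<alpha> \<le> 2 * CARD('n) + 1 \<Longrightarrow> x \<in> unit_cube \<Longrightarrow> \<bar>pderivs \<alpha> (Delta j \<phi> k) x\<bar> \<le> C2"
    and c: "c > 0" "\<And>x k l. x \<in> unit_cube \<Longrightarrow> norm (grad (\<phi> k) x - grad (\<phi> l) x) \<ge> c * norm (lat k - lat l)"
  shows "\<exists>A. bounded_operator_ell2 A \<and> (\<forall>f\<in>schwartz_lattice. A f = T_lattice \<phi> \<sigma> f)"
proof -
  define s where "s k x = exp (\<i> * complex_of_real (\<phi> k x)) * \<sigma> k x" for k x
  have \<sigma>1: "derivs_bounded (Suc (2 * CARD('n))) C1 (\<sigma> k)" for k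
    using \<sigma>(1)[of k] by (intro derivs_boundedI per) (auto intro: \<sigma>(2))
  then have \<sigma>2: "derivs_bounded (2 * CARD('n)) C1 (\<sigma> k)" for k
    by (rule derivs_bounded_SucD)
  have \<sigma>B: "cmod (\<sigma> k x) \<le> C1" for k x
    using \<sigma>2 by (rule derivs_bounded_norm_le)
  have "continuous_on UNIV (\<phi> k)" "continuous_on UNIV (\<sigma> k)" for k
    using \<phi> \<sigma>1[of k] by (auto intro!: continuous_at_imp_continuous_on differentiable_imp_continuous_within)
  then have sm: "s k \<in> borel_measurable torus_measure" for k
    unfolding s_def[abs_def] by (intro borel_measurable_torus continuous_intros)
  have sB: "cmod (s k x) \<le> C1" for k x
    using \<sigma>B by (simp add: s_def norm_mult)
  have "\<exists>K. \<forall>k l. cmod (torus_inner (s k) (s l)) \<le> K * lattice_decay (k - l)"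
    unfolding s_def[abs_def]
    by (rule oscillatory_kernel_decay[OF per \<sigma>2 \<phi> \<Delta>(1) _ c(1)]) (fact \<Delta>(2), fact c(2))
  then obtain K where "\<And>k l. cmod (torus_inner (s k) (s l)) \<le> K * lattice_decay (k - l)"
    by blast
  then have "bounded_operator_ell2 (\<lambda>f k. \<Sum>\<^sub>\<infinity>l. F_torus (s k) l * f l)"
    by (rule bounded_operator_almost_orthogonal[OF sm sB])
  moreover have "(\<lambda>k. \<Sum>\<^sub>\<infinity>l. F_torus (s k) l * f l) = T_lattice \<phi> \<sigma> f" if "f \<in> schwartz_lattice" for f
    using T_lattice_eq_matrix[OF that _ \<sigma>B] sm unfolding s_def[abs_def] by (simp add: fun_eq_iff)
  ultimately show ?thesis
    by blast
qed

theorem theorem5p14: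
  fixes \<phi> :: "int ^ 'n \<Rightarrow> real ^ 'n \<Rightarrow> real"
    and \<sigma> :: "int ^ 'n \<Rightarrow> real ^ 'n \<Rightarrow> complex"
    and \<psi> :: "real ^ 'n \<Rightarrow> int ^ 'n \<Rightarrow> real"
    and \<tau> :: "real ^ 'n \<Rightarrow> int ^ 'n \<Rightarrow> complex"
  assumes "\<And>k. periodic (\<lambda>x. exp (\<i> * complex_of_real (\<phi> k x)))"
    and "\<And>k. periodic (\<sigma> k)"
    and "\<And>x k. \<tau> x k = cnj (\<sigma> (- k) x)"
    and "\<And>x k. \<psi> x k = - \<phi> (- k) x"
  shows
    "(\<forall>f\<in>schwartz_lattice.
        T_lattice \<phi> \<sigma> f = F_lattice_inv_gen (formal_adjoint (T_torus \<psi> \<tau>) (F_lattice f)) \<and>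
        (\<forall>u. L2_adjoint (T_torus \<psi> \<tau>) (F_lattice f) u \<longrightarrow> T_lattice \<phi> \<sigma> f = F_lattice_inv u) \<and>
        (T_torus_into_L2 \<psi> \<tau> \<longrightarrow>
           ((\<exists>u. L2_adjoint (T_torus \<psi> \<tau>) (F_lattice f) u) \<longleftrightarrow> T_lattice \<phi> \<sigma> f \<in> ell2)))
     \<and>
     ((\<forall>k. times_differentiable (2 * CARD('n) + 1) (\<sigma> k)) \<and>
      (\<forall>k j. times_differentiable (2 * CARD('n) + 1) (Delta j \<phi> k)) \<and>
      (\<forall>k x. \<phi> k differentiable (at x)) \<and>
      (\<exists>C. \<forall>\<alpha>. length \<alpha> \<le> 2 * CARD('n) + 1 \<longrightarrow>
         (\<forall>k. \<forall>x\<in>unit_cube. cmod (pderivs \<alpha> (\<sigma> k) x) \<le> C)) \<and>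
      (\<exists>C. \<forall>\<alpha> j. length \<alpha> \<le> 2 * CARD('n) + 1 \<longrightarrow>
         (\<forall>k. \<forall>x\<in>unit_cube. \<bar>pderivs \<alpha> (Delta j \<phi> k) x\<bar> \<le> C)) \<and>
      (\<exists>C>0. \<forall>x\<in>unit_cube. \<forall>k l.
         norm (grad (\<phi> k) x - grad (\<phi> l) x) \<ge> C * norm (lat k - lat l))
      \<longrightarrow>
      (\<exists>A. bounded_operator_ell2 A \<and> (\<forall>f\<in>schwartz_lattice. A f = T_lattice \<phi> \<sigma> f)))"
proof (intro conjI ballI allI impI, goal_cases)
  case (1 f)
  show ?case
    by (rule T_lattice_eq_formal_adjoint[where \<sigma> = \<sigma> and \<phi> = \<phi>, OF assms(3,4)])
next
  case (2 f u)
  then show ?case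
    by (intro T_lattice_eq_adjoint[where \<sigma> = \<sigma> and \<phi> = \<phi>, OF assms(3,4)])
next
  case (3 f)
  then show ?case
    using T_lattice_ell2_if_adjoint[where \<sigma> = \<sigma> and \<phi> = \<phi>, OF assms(3,4)]
      adjoint_if_T_lattice_ell2[where \<sigma> = \<sigma> and \<phi> = \<phi>, OF assms(3,4)] by blast
next
  case 4
  then obtain C1 C2 c where
    "\<forall>\<alpha>. length \<alpha> \<le> 2 * CARD('n) + 1 \<longrightarrow> (\<forall>k. \<forall>x\<in>unit_cube. cmod (pderivs \<alpha> (\<sigma> k) x) \<le> C1)"
    "\<forall>\<alpha> j. length \<alpha> \<le> 2 * CARD('n) + 1 \<longrightarrow> (\<forall>k. \<forall>x\<in>unit_cube. \<bar>pderivs \<alpha> (Delta j \<phi> k) x\<bar> \<le> C2)"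
    "c > 0" "\<forall>x\<in>unit_cube. \<forall>k l. norm (grad (\<phi> k) x - grad (\<phi> l) x) \<ge> c * norm (lat k - lat l)"
    by blast
  then show ?case
    using 4 by (intro T_lattice_extends[where ?C1.0 = C1 and ?C2.0 = C2 and c = c, OF assms(1,2)]) simp_all
qed

end
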